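(* Let $R$ be a ring. All $R$-modules of finite length have only finitely many submodules if and only if every simple $R$-module $S$ has a finite endomorphism ring $\mathrm{End}_R(S)$.
   Context: Rings are associative with unity (not necessarily commutative); modules are left modules. *)

theory Defs
  imports "HOL-Algebra.Module" "HOL-Algebra.AbelCoset"
begin

text \<open>
  The library locale \<open>module\<close> demands a commutative ring of scalars. Here the scalars form an
  arbitrary ring with unity; the record type and the notion of submodule are those of the library.

  A module has its carrier inside a type \<open>'m\<close>, so quantifying over all modules of type
  \<open>('r, 'm) module\<close> for an unconstrained \<open>'m\<close> is quantifying over a universe of modules,
  with \<open>'m\<close> arbitrary.
\<close>

locale left_module = R?: ring R + M?: abelian_group M
  for R :: "('r, 'a) ring_scheme" (structure) and M :: "('r, 'm, 'b) module_scheme" (structure) +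
  assumes smult_closed [simp, intro]:
      "\<lbrakk>a \<in> carrier R; x \<in> carrier M\<rbrakk> \<Longrightarrow> a \<odot>\<^bsub>M\<^esub> x \<in> carrier M"
    and smult_l_distr:
      "\<lbrakk>a \<in> carrier R; b \<in> carrier R; x \<in> carrier M\<rbrakk> \<Longrightarrow>
      (a \<oplus> b) \<odot>\<^bsub>M\<^esub> x = a \<odot>\<^bsub>M\<^esub> x \<oplus>\<^bsub>M\<^esub> b \<odot>\<^bsub>M\<^esub> x"
    and smult_r_distr:
      "\<lbrakk>a \<in> carrier R; x \<in> carrier M; y \<in> carrier M\<rbrakk> \<Longrightarrow>
      a \<odot>\<^bsub>M\<^esub> (x \<oplus>\<^bsub>M\<^esub> y) = a \<odot>\<^bsub>M\<^esub> x \<oplus>\<^bsub>M\<^esub> a \<odot>\<^bsub>M\<^esub> y"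
    and smult_assoc1:
      "\<lbrakk>a \<in> carrier R; b \<in> carrier R; x \<in> carrier M\<rbrakk> \<Longrightarrow>
      (a \<otimes> b) \<odot>\<^bsub>M\<^esub> x = a \<odot>\<^bsub>M\<^esub> (b \<odot>\<^bsub>M\<^esub> x)"
    and smult_one [simp]:
      "x \<in> carrier M \<Longrightarrow> \<one> \<odot>\<^bsub>M\<^esub> x = x"

definition simple_module :: "('r, 'a) ring_scheme \<Rightarrow> ('r, 'm, 'b) module_scheme \<Rightarrow> bool" where
  "simple_module R M \<longleftrightarrow>
     left_module R M \<and> carrier M \<noteq> {\<zero>\<^bsub>M\<^esub>} \<and>
     (\<forall>N. submodule N R M \<longrightarrow> N = {\<zero>\<^bsub>M\<^esub>} \<or> N = carrier M)"

text \<open>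
  The fields \<open>mult\<close> and \<open>one\<close> of a module record play no role, hence \<open>undefined\<close> below.
\<close>

definition quot_module :: "('r, 'm, 'b) module_scheme \<Rightarrow> 'm set \<Rightarrow> ('r, 'm set) module" where
  "quot_module M N =
     \<lparr>carrier = a_rcosets\<^bsub>M\<^esub> N, mult = undefined, one = undefined,
      zero = N, add = set_add M,
      smult = (\<lambda>a A. \<Union>x\<in>A. N +>\<^bsub>M\<^esub> (a \<odot>\<^bsub>M\<^esub> x))\<rparr>"

definition composition_series ::
    "('r, 'a) ring_scheme \<Rightarrow> ('r, 'm, 'b) module_scheme \<Rightarrow> 'm set list \<Rightarrow> bool" where
  "composition_series R M Ns \<longleftrightarrow>
     Ns \<noteq> [] \<and> hd Ns = {\<zero>\<^bsub>M\<^esub>} \<and> last Ns = carrier M \<and>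
     (\<forall>N \<in> set Ns. submodule N R M) \<and>
     (\<forall>i. Suc i < length Ns \<longrightarrow>
        Ns ! i \<subseteq> Ns ! Suc i \<and>
        simple_module R (quot_module (M\<lparr>carrier := Ns ! Suc i\<rparr>) (Ns ! i)))"

definition finite_length :: "('r, 'a) ring_scheme \<Rightarrow> ('r, 'm, 'b) module_scheme \<Rightarrow> bool" where
  "finite_length R M \<longleftrightarrow> left_module R M \<and> (\<exists>Ns. composition_series R M Ns)"

text \<open>
  Endomorphisms are taken to be extensional, that is, \<open>undefined\<close> outside the carrier, so that
  each endomorphism is represented by exactly one HOL function.
\<close>

definition module_end :: "('r, 'a) ring_scheme \<Rightarrow> ('r, 'm, 'b) module_scheme \<Rightarrow> ('m \<Rightarrow> 'm) set" where
  "module_end R M =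
     {f \<in> carrier M \<rightarrow>\<^sub>E carrier M.
        (\<forall>x \<in> carrier M. \<forall>y \<in> carrier M. f (x \<oplus>\<^bsub>M\<^esub> y) = f x \<oplus>\<^bsub>M\<^esub> f y) \<and>
        (\<forall>a \<in> carrier R. \<forall>x \<in> carrier M. f (a \<odot>\<^bsub>M\<^esub> x) = a \<odot>\<^bsub>M\<^esub> f x)}"

definition end_ring :: "('r, 'a) ring_scheme \<Rightarrow> ('r, 'm, 'b) module_scheme \<Rightarrow> ('m \<Rightarrow> 'm) ring" where
  "end_ring R M =
     \<lparr>carrier = module_end R M,
      mult = compose (carrier M), one = (\<lambda>x \<in> carrier M. x),
      zero = (\<lambda>x \<in> carrier M. \<zero>\<^bsub>M\<^esub>),
      add = (\<lambda>f g. \<lambda>x \<in> carrier M. f x \<oplus>\<^bsub>M\<^esub> g x)\<rparr>"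

context left_module
begin

lemma smult_r_null [simp]:
  assumes "a \<in> carrier R" shows "a \<odot>\<^bsub>M\<^esub> \<zero>\<^bsub>M\<^esub> = \<zero>\<^bsub>M\<^esub>"
proof -
  have "a \<odot>\<^bsub>M\<^esub> \<zero>\<^bsub>M\<^esub> = a \<odot>\<^bsub>M\<^esub> \<zero>\<^bsub>M\<^esub> \<oplus>\<^bsub>M\<^esub> a \<odot>\<^bsub>M\<^esub> \<zero>\<^bsub>M\<^esub>"
    using smult_r_distr[OF assms, of "\<zero>\<^bsub>M\<^esub>" "\<zero>\<^bsub>M\<^esub>"] by simp
  then show ?thesis
    using assms by (metis M.add.r_cancel_one' M.zero_closed smult_closed)
qed

lemma smult_r_minus:
  assumes "a \<in> carrier R" "x \<in> carrier M"
  shows "a \<odot>\<^bsub>M\<^esub> (\<ominus>\<^bsub>M\<^esub> x) = \<ominus>\<^bsub>M\<^esub> (a \<odot>\<^bsub>M\<^esub> x)"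
proof -
  have "a \<odot>\<^bsub>M\<^esub> (\<ominus>\<^bsub>M\<^esub> x) \<oplus>\<^bsub>M\<^esub> a \<odot>\<^bsub>M\<^esub> x = \<zero>\<^bsub>M\<^esub>"
    using assms smult_r_distr[of a "\<ominus>\<^bsub>M\<^esub> x" x] by (simp add: M.l_neg)
  then show ?thesis
    using assms M.minus_equality[of "a \<odot>\<^bsub>M\<^esub> (\<ominus>\<^bsub>M\<^esub> x)" "a \<odot>\<^bsub>M\<^esub> x"] by simp
qed

lemma submodule_left_module:
  assumes "submodule N R M"
  shows "left_module R (M\<lparr>carrier := N\<rparr>)"
proof -
  interpret N: submodule N R M by fact
  have sub: "N \<subseteq> carrier M" using N.subset by simp
  have am: "abelian_monoid (M\<lparr>carrier := N\<rparr>)"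
    using comm_monoid.submonoid_is_comm_monoid[OF M.a_comm_monoid
        N.subgroup_is_submonoid]
    by (simp add: abelian_monoid_def)
  have "abelian_group (M\<lparr>carrier := N\<rparr>)"
    using am N.subgroup_is_group[OF M.a_group]
    by (simp add: abelian_group_def abelian_group_axioms_def comm_group_def abelian_monoid_def)
  then show ?thesis
    using R.ring_axioms subsetD[OF sub]
    by (intro left_module.intro left_module_axioms.intro)
       (simp_all add: smult_l_distr smult_r_distr smult_assoc1)
qed

lemma quot_smult:
  assumes "submodule N R M" "a \<in> carrier R" "x \<in> carrier M"
  shows "a \<odot>\<^bsub>quot_module M N\<^esub> (N +>\<^bsub>M\<^esub> x) = N +>\<^bsub>M\<^esub> (a \<odot>\<^bsub>M\<^esub> x)"
proof -
  interpret N: submodule N R M by fact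
  interpret N: abelian_subgroup N M
    by (intro abelian_subgroupI3 additive_subgroup.intro N.subgroup_axioms M.abelian_group_axioms)
  have "N +>\<^bsub>M\<^esub> (a \<odot>\<^bsub>M\<^esub> y) = N +>\<^bsub>M\<^esub> (a \<odot>\<^bsub>M\<^esub> x)" if y: "y \<in> N +>\<^bsub>M\<^esub> x" for y
  proof -
    obtain n where n: "n \<in> N" and yn: "y = n \<oplus>\<^bsub>M\<^esub> x"
      using y by (auto simp: a_r_coset_def')
    have "a \<odot>\<^bsub>M\<^esub> y = a \<odot>\<^bsub>M\<^esub> n \<oplus>\<^bsub>M\<^esub> a \<odot>\<^bsub>M\<^esub> x"
      using yn n assms N.a_Hcarr by (simp add: smult_r_distr)
    moreover have "a \<odot>\<^bsub>M\<^esub> n \<in> N" using n assms by simp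
    ultimately have "a \<odot>\<^bsub>M\<^esub> y \<in> N +>\<^bsub>M\<^esub> (a \<odot>\<^bsub>M\<^esub> x)"
      by (auto simp: a_r_coset_def')
    then show ?thesis
      using assms N.a_repr_independence' by auto
  qed
  then have "(\<Union>y \<in> N +>\<^bsub>M\<^esub> x. N +>\<^bsub>M\<^esub> (a \<odot>\<^bsub>M\<^esub> y)) = N +>\<^bsub>M\<^esub> (a \<odot>\<^bsub>M\<^esub> x)"
    using N.a_rcos_self[OF assms(3)] by (intro UN_constant_eq[of x]) blast+
  then show ?thesis
    by (simp add: quot_module_def)
qed

lemma quot_left_module:
  assumes "submodule N R M"
  shows "left_module R (quot_module M N)"
proof -
  interpret N: submodule N R M by fact
  interpret N: abelian_subgroup N M
    by (intro abelian_subgroupI3 additive_subgroup.intro N.subgroup_axioms M.abelian_group_axioms)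
  let ?Q = "quot_module M N"
  have car: "X \<in> carrier ?Q \<longleftrightarrow> (\<exists>x \<in> carrier M. X = N +>\<^bsub>M\<^esub> x)" for X
    by (auto simp: quot_module_def A_RCOSETS_def')
  have add: "(N +>\<^bsub>M\<^esub> x) \<oplus>\<^bsub>?Q\<^esub> (N +>\<^bsub>M\<^esub> y) = N +>\<^bsub>M\<^esub> (x \<oplus>\<^bsub>M\<^esub> y)"
    if "x \<in> carrier M" "y \<in> carrier M" for x y
    using that N.a_rcos_sum by (simp add: quot_module_def)
  have zero: "\<zero>\<^bsub>?Q\<^esub> = N +>\<^bsub>M\<^esub> \<zero>\<^bsub>M\<^esub>"
    using M.a_coset_add_zero N.a_subset by (simp add: quot_module_def)
  have rep: "\<exists>x \<in> carrier M. X = N +>\<^bsub>M\<^esub> x" if "X \<in> carrier ?Q" for X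
    using that car by blast
  have cl: "N +>\<^bsub>M\<^esub> x \<in> carrier ?Q" if "x \<in> carrier M" for x
    using that car by blast
  have "abelian_group ?Q"
  proof (rule abelian_groupI)
    fix X assume "X \<in> carrier ?Q"
    then obtain x where x: "x \<in> carrier M" "X = N +>\<^bsub>M\<^esub> x" using rep by blast
    show "\<zero>\<^bsub>?Q\<^esub> \<oplus>\<^bsub>?Q\<^esub> X = X"
      using x by (simp add: add zero del: M.a_coset_add_zero)
    have "(N +>\<^bsub>M\<^esub> (\<ominus>\<^bsub>M\<^esub> x)) \<oplus>\<^bsub>?Q\<^esub> X = \<zero>\<^bsub>?Q\<^esub>"
      using x by (simp add: add zero M.l_neg)
    then show "\<exists>Y \<in> carrier ?Q. Y \<oplus>\<^bsub>?Q\<^esub> X = \<zero>\<^bsub>?Q\<^esub>"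
      using x cl[of "\<ominus>\<^bsub>M\<^esub> x"] by blast
    fix Y assume "Y \<in> carrier ?Q"
    then obtain y where y: "y \<in> carrier M" "Y = N +>\<^bsub>M\<^esub> y" using rep by blast
    show "X \<oplus>\<^bsub>?Q\<^esub> Y \<in> carrier ?Q" using x y by (simp add: add cl)
    show "X \<oplus>\<^bsub>?Q\<^esub> Y = Y \<oplus>\<^bsub>?Q\<^esub> X" using x y by (simp add: add M.a_comm)
    fix Z assume "Z \<in> carrier ?Q"
    then obtain z where z: "z \<in> carrier M" "Z = N +>\<^bsub>M\<^esub> z" using rep by blast
    show "X \<oplus>\<^bsub>?Q\<^esub> Y \<oplus>\<^bsub>?Q\<^esub> Z = X \<oplus>\<^bsub>?Q\<^esub> (Y \<oplus>\<^bsub>?Q\<^esub> Z)"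
      using x y z by (simp add: add M.a_assoc)
  next
    show "\<zero>\<^bsub>?Q\<^esub> \<in> carrier ?Q" unfolding zero by (rule cl) simp
  qed
  moreover have "left_module_axioms R ?Q"
  proof
    fix X assume "X \<in> carrier ?Q"
    then obtain x where x: "x \<in> carrier M" "X = N +>\<^bsub>M\<^esub> x" using rep by blast
    show "\<one> \<odot>\<^bsub>?Q\<^esub> X = X" using x by (simp add: quot_smult[OF assms])
    fix a assume a: "a \<in> carrier R"
    show "a \<odot>\<^bsub>?Q\<^esub> X \<in> carrier ?Q" using a x by (simp add: quot_smult[OF assms] cl)
    show "a \<odot>\<^bsub>?Q\<^esub> (X \<oplus>\<^bsub>?Q\<^esub> Y) = a \<odot>\<^bsub>?Q\<^esub> X \<oplus>\<^bsub>?Q\<^esub> a \<odot>\<^bsub>?Q\<^esub> Y"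
      if Y: "Y \<in> carrier ?Q" for Y
    proof -
      obtain y where y: "y \<in> carrier M" "Y = N +>\<^bsub>M\<^esub> y" using rep[OF Y] by blast
      then show ?thesis using a x by (simp add: add quot_smult[OF assms] smult_r_distr)
    qed
    fix b assume b: "b \<in> carrier R"
    show "(a \<oplus> b) \<odot>\<^bsub>?Q\<^esub> X = a \<odot>\<^bsub>?Q\<^esub> X \<oplus>\<^bsub>?Q\<^esub> b \<odot>\<^bsub>?Q\<^esub> X"
      using a b x by (simp add: add quot_smult[OF assms] smult_l_distr)
    show "(a \<otimes> b) \<odot>\<^bsub>?Q\<^esub> X = a \<odot>\<^bsub>?Q\<^esub> (b \<odot>\<^bsub>?Q\<^esub> X)"
      using a b x by (simp add: quot_smult[OF assms] smult_assoc1)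
  qed
  ultimately show ?thesis using R.ring_axioms by (intro left_module.intro)
qed

lemma end_ring_ring: "ring (end_ring R M)"
proof -
  let ?E = "end_ring R M"
  have ext: "f = g" if "f \<in> carrier ?E" "g \<in> carrier ?E" "\<And>x. x \<in> carrier M \<Longrightarrow> f x = g x" for f g
    using that by (intro PiE_ext[of f "carrier M" "\<lambda>_. carrier M" g])
      (auto simp: end_ring_def module_end_def)
  have cl: "f x \<in> carrier M" if "f \<in> carrier ?E" "x \<in> carrier M" for f x
    using that by (auto simp: end_ring_def module_end_def)
  have hom: "f (x \<oplus>\<^bsub>M\<^esub> y) = f x \<oplus>\<^bsub>M\<^esub> f y"
    if "f \<in> carrier ?E" "x \<in> carrier M" "y \<in> carrier M" for f x y
    using that by (auto simp: end_ring_def module_end_def)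
  have lin: "f (a \<odot>\<^bsub>M\<^esub> x) = a \<odot>\<^bsub>M\<^esub> f x"
    if "f \<in> carrier ?E" "a \<in> carrier R" "x \<in> carrier M" for f a x
    using that by (auto simp: end_ring_def module_end_def)
  have I: "(\<lambda>x \<in> carrier M. h x) \<in> carrier ?E"
    if "\<And>x. x \<in> carrier M \<Longrightarrow> h x \<in> carrier M"
      "\<And>x y. \<lbrakk>x \<in> carrier M; y \<in> carrier M\<rbrakk> \<Longrightarrow> h (x \<oplus>\<^bsub>M\<^esub> y) = h x \<oplus>\<^bsub>M\<^esub> h y"
      "\<And>a x. \<lbrakk>a \<in> carrier R; x \<in> carrier M\<rbrakk> \<Longrightarrow> h (a \<odot>\<^bsub>M\<^esub> x) = a \<odot>\<^bsub>M\<^esub> h x" for h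
    using that by (auto simp: end_ring_def module_end_def)
  have addE: "f \<oplus>\<^bsub>?E\<^esub> g = (\<lambda>x \<in> carrier M. f x \<oplus>\<^bsub>M\<^esub> g x)" for f g
    by (simp add: end_ring_def)
  have mulE: "f \<otimes>\<^bsub>?E\<^esub> g = (\<lambda>x \<in> carrier M. f (g x))" for f g
    by (simp add: end_ring_def compose_def)
  have oneE: "\<one>\<^bsub>?E\<^esub> = (\<lambda>x \<in> carrier M. x)" by (simp add: end_ring_def)
  have zeroE: "\<zero>\<^bsub>?E\<^esub> = (\<lambda>x \<in> carrier M. \<zero>\<^bsub>M\<^esub>)" by (simp add: end_ring_def)
  have add_cl: "f \<oplus>\<^bsub>?E\<^esub> g \<in> carrier ?E" if "f \<in> carrier ?E" "g \<in> carrier ?E" for f g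
    unfolding addE using that by (intro I) (simp_all add: cl hom lin smult_r_distr M.a_ac)
  have mul_cl: "f \<otimes>\<^bsub>?E\<^esub> g \<in> carrier ?E" if "f \<in> carrier ?E" "g \<in> carrier ?E" for f g
    unfolding mulE using that by (intro I) (simp_all add: cl hom lin)
  have one_cl: "\<one>\<^bsub>?E\<^esub> \<in> carrier ?E" unfolding oneE by (intro I) simp_all
  have zero_cl: "\<zero>\<^bsub>?E\<^esub> \<in> carrier ?E" unfolding zeroE by (intro I) simp_all
  have neg_cl: "(\<lambda>x \<in> carrier M. \<ominus>\<^bsub>M\<^esub> f x) \<in> carrier ?E" if "f \<in> carrier ?E" for f
    using that by (intro I) (simp_all add: cl hom lin smult_r_minus M.minus_add)
  have "abelian_group ?E"
  proof (rule abelian_groupI)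
    show "\<exists>g \<in> carrier ?E. g \<oplus>\<^bsub>?E\<^esub> f = \<zero>\<^bsub>?E\<^esub>" if "f \<in> carrier ?E" for f
      using that
      by (intro bexI[OF _ neg_cl[OF that]] ext add_cl zero_cl neg_cl)
         (simp_all add: addE zeroE cl M.l_neg)
  next
    show "f \<oplus>\<^bsub>?E\<^esub> g \<oplus>\<^bsub>?E\<^esub> h = f \<oplus>\<^bsub>?E\<^esub> (g \<oplus>\<^bsub>?E\<^esub> h)"
      if "f \<in> carrier ?E" "g \<in> carrier ?E" "h \<in> carrier ?E" for f g h
      using that by (intro ext add_cl) (simp_all add: addE cl M.a_assoc)
    show "f \<oplus>\<^bsub>?E\<^esub> g = g \<oplus>\<^bsub>?E\<^esub> f" if "f \<in> carrier ?E" "g \<in> carrier ?E" for f g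
      using that by (intro ext add_cl) (simp_all add: addE cl M.a_comm)
    show "\<zero>\<^bsub>?E\<^esub> \<oplus>\<^bsub>?E\<^esub> f = f" if "f \<in> carrier ?E" for f
      using that by (intro ext add_cl zero_cl) (simp_all add: addE zeroE cl)
  qed (simp_all add: add_cl zero_cl)
  moreover have "monoid ?E"
  proof (rule monoidI)
    show "f \<otimes>\<^bsub>?E\<^esub> g \<otimes>\<^bsub>?E\<^esub> h = f \<otimes>\<^bsub>?E\<^esub> (g \<otimes>\<^bsub>?E\<^esub> h)"
      if "f \<in> carrier ?E" "g \<in> carrier ?E" "h \<in> carrier ?E" for f g h
      using that by (intro ext mul_cl) (simp_all add: mulE cl)
    show "\<one>\<^bsub>?E\<^esub> \<otimes>\<^bsub>?E\<^esub> f = f" if "f \<in> carrier ?E" for f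
      using that by (intro ext mul_cl one_cl) (simp_all add: mulE oneE cl)
    show "f \<otimes>\<^bsub>?E\<^esub> \<one>\<^bsub>?E\<^esub> = f" if "f \<in> carrier ?E" for f
      using that by (intro ext mul_cl one_cl) (simp_all add: mulE oneE cl)
  qed (simp_all add: mul_cl one_cl)
  ultimately show ?thesis
  proof (rule ringI)
    show "(f \<oplus>\<^bsub>?E\<^esub> g) \<otimes>\<^bsub>?E\<^esub> h = f \<otimes>\<^bsub>?E\<^esub> h \<oplus>\<^bsub>?E\<^esub> g \<otimes>\<^bsub>?E\<^esub> h"
      if "f \<in> carrier ?E" "g \<in> carrier ?E" "h \<in> carrier ?E" for f g h
      using that by (intro ext mul_cl add_cl) (simp_all add: mulE addE cl)
    show "h \<otimes>\<^bsub>?E\<^esub> (f \<oplus>\<^bsub>?E\<^esub> g) = h \<otimes>\<^bsub>?E\<^esub> f \<oplus>\<^bsub>?E\<^esub> h \<otimes>\<^bsub>?E\<^esub> g"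
      if "f \<in> carrier ?E" "g \<in> carrier ?E" "h \<in> carrier ?E" for f g h
      using that by (intro ext mul_cl add_cl) (simp_all add: mulE addE cl hom)
  qed
qed

end

end

theory Submission
  imports Defs
begin

text \<open>
  Suppose all simple modules have finite endomorphism rings. By induction along a composition
  series it suffices to pass from a submodule \<open>L\<close> to \<open>M\<close> when \<open>M / L\<close> is simple. Fix \<open>x \<in> M - L\<close>.
  A submodule \<open>N\<close> not inside \<open>L\<close> contains some \<open>x + l\<close> with \<open>l \<in> L\<close>, and is determined by
  \<open>K = N \<inter> L\<close> and the class of \<open>l\<close> modulo \<open>K\<close>. The difference \<open>d\<close> of two such \<open>l\<close> (for the same
  \<open>K\<close>) is the image of \<open>x\<close> under a homomorphism \<open>M / L \<rightarrow> L / K\<close>. The image of this homomorphism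
  corresponds to one of finitely many submodules of \<open>L\<close>, and two such homomorphisms with the same
  nonzero image differ by an endomorphism of \<open>M / L\<close>.

  Conversely, the graphs of the endomorphisms of a simple module \<open>S\<close> are distinct submodules of
  \<open>S \<oplus> S\<close>, which has length two. If \<open>S\<close> has infinitely many endomorphisms then it is infinite, so
  \<open>S \<times> S\<close> is equipotent to \<open>S\<close> and \<open>S \<oplus> S\<close> has a copy in the type of \<open>S\<close>; likewise a quotient,
  whose elements are sets, has a copy in the original type.
\<close>

text \<open>Pigeonhole: an infinite set with finite image would have an infinite fibre. In the
  inductive step it is used twice, first for \<open>N \<inter> L\<close> as a function of
  \<open>N\<close>, then for the image of the homomorphism attached to \<open>N\<close>.\<close>

lemma finite_fibres:
  assumes "finite (f ` A)" "\<And>a. a \<in> A \<Longrightarrow> finite {b \<in> A. f b = f a}"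
  shows "finite A"
  using assms pigeonhole_infinite[of A f] by blast

section \<open>Elementary facts on submodules over a noncommutative ring\<close>

context left_module
begin

lemma smult_l_null:
  assumes "x \<in> carrier M" shows "\<zero> \<odot>\<^bsub>M\<^esub> x = \<zero>\<^bsub>M\<^esub>"
proof -
  have "\<zero> \<odot>\<^bsub>M\<^esub> x = \<zero> \<odot>\<^bsub>M\<^esub> x \<oplus>\<^bsub>M\<^esub> \<zero> \<odot>\<^bsub>M\<^esub> x"
    using smult_l_distr[OF R.zero_closed R.zero_closed assms] by simp
  then show ?thesis
    using assms by (metis M.add.r_cancel_one' R.zero_closed smult_closed)
qed

lemma smult_l_minus:
  assumes "a \<in> carrier R" "x \<in> carrier M"
  shows "(\<ominus> a) \<odot>\<^bsub>M\<^esub> x = \<ominus>\<^bsub>M\<^esub> (a \<odot>\<^bsub>M\<^esub> x)"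
proof -
  have "(\<ominus> a) \<odot>\<^bsub>M\<^esub> x \<oplus>\<^bsub>M\<^esub> a \<odot>\<^bsub>M\<^esub> x = \<zero>\<^bsub>M\<^esub>"
    using assms smult_l_distr[of "\<ominus> a" a x] by (simp add: R.l_neg smult_l_null)
  then show ?thesis
    using assms M.minus_equality[of "(\<ominus> a) \<odot>\<^bsub>M\<^esub> x" "a \<odot>\<^bsub>M\<^esub> x"] by simp
qed

text \<open>Closure under negation can be left out of the criterion, because the negative of
  \<open>x\<close> is the scalar \<open>\<ominus> \<one>\<close> times \<open>x\<close>.\<close>

lemma submodule_iff:
  "submodule N R M \<longleftrightarrow>
     N \<subseteq> carrier M \<and> \<zero>\<^bsub>M\<^esub> \<in> N \<and> (\<forall>x\<in>N. \<forall>y\<in>N. x \<oplus>\<^bsub>M\<^esub> y \<in> N) \<and>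
     (\<forall>a\<in>carrier R. \<forall>x\<in>N. a \<odot>\<^bsub>M\<^esub> x \<in> N)" (is "_ \<longleftrightarrow> ?r")
proof
  assume "submodule N R M"
  then interpret N: submodule N R M .
  show ?r using N.subset N.one_closed N.m_closed by auto
next
  assume r: ?r
  have "\<ominus>\<^bsub>M\<^esub> x \<in> N" if "x \<in> N" for x
  proof -
    have "(\<ominus> \<one>) \<odot>\<^bsub>M\<^esub> x \<in> N" using r that by simp
    moreover have "x \<in> carrier M" using r that by blast
    ultimately show ?thesis using smult_l_minus[of \<one> x] by simp
  qed
  then show "submodule N R M"
    using r by (intro submodule.intro subgroup.intro submodule_axioms.intro) (auto simp: a_inv_def)
qed

lemma
  assumes "submodule N R M"
  shows submodule_subset: "N \<subseteq> carrier M"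
    and submodule_carr: "x \<in> N \<Longrightarrow> x \<in> carrier M"
    and submodule_zero: "\<zero>\<^bsub>M\<^esub> \<in> N"
    and submodule_add: "x \<in> N \<Longrightarrow> y \<in> N \<Longrightarrow> x \<oplus>\<^bsub>M\<^esub> y \<in> N"
    and submodule_smult: "a \<in> carrier R \<Longrightarrow> x \<in> N \<Longrightarrow> a \<odot>\<^bsub>M\<^esub> x \<in> N"
    and submodule_neg: "x \<in> N \<Longrightarrow> \<ominus>\<^bsub>M\<^esub> x \<in> N"
proof -
  show "N \<subseteq> carrier M" "x \<in> N \<Longrightarrow> x \<in> carrier M" "\<zero>\<^bsub>M\<^esub> \<in> N"
    "x \<in> N \<Longrightarrow> y \<in> N \<Longrightarrow> x \<oplus>\<^bsub>M\<^esub> y \<in> N" "a \<in> carrier R \<Longrightarrow> x \<in> N \<Longrightarrow> a \<odot>\<^bsub>M\<^esub> x \<in> N"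
    using assms by (auto simp: submodule_iff)
  show "\<ominus>\<^bsub>M\<^esub> x \<in> N" if "x \<in> N"
    using subgroup.m_inv_closed[OF submodule.axioms(1)[OF assms]] that by (simp add: a_inv_def)
qed

lemma submodule_cancel:
  assumes "submodule N R M" "u \<in> N" "u \<oplus>\<^bsub>M\<^esub> v \<in> N" "v \<in> carrier M"
  shows "v \<in> N"
proof -
  have "\<ominus>\<^bsub>M\<^esub> u \<oplus>\<^bsub>M\<^esub> (u \<oplus>\<^bsub>M\<^esub> v) \<in> N"
    using assms submodule_add[OF assms(1) submodule_neg[OF assms(1,2)] assms(3)] by simp
  then show ?thesis
    using assms submodule_carr[OF assms(1)] by (simp add: M.r_neg1)
qed

lemma submodule_carrier: "submodule (carrier M) R M"
  by (simp add: submodule_iff)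

lemma submodule_null: "submodule {\<zero>\<^bsub>M\<^esub>} R M"
  by (simp add: submodule_iff)

lemma submodule_inter: "submodule N R M \<Longrightarrow> submodule N' R M \<Longrightarrow> submodule (N \<inter> N') R M"
  by (auto simp: submodule_iff)

lemma submodule_restrict_iff:
  assumes "submodule A R M"
  shows "submodule N R (M\<lparr>carrier := A\<rparr>) \<longleftrightarrow> submodule N R M \<and> N \<subseteq> A"
proof -
  interpret A: left_module R "M\<lparr>carrier := A\<rparr>" by (rule submodule_left_module[OF assms])
  show ?thesis
    using submodule_subset[OF assms] by (auto simp: submodule_iff A.submodule_iff)
qed

section \<open>Counting the submodules not contained in a given submodule\<close>

lemma submodule_cyclic_plus:
  assumes K: "submodule K R M" and d: "d \<in> carrier M"
  shows "submodule {r \<odot>\<^bsub>M\<^esub> d \<oplus>\<^bsub>M\<^esub> k | r k. r \<in> carrier R \<and> k \<in> K} R M" (is "submodule ?P R M")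
  unfolding submodule_iff
proof (intro conjI ballI)
  note [simp] = submodule_carr[OF K] submodule_add[OF K] submodule_smult[OF K]
  show "?P \<subseteq> carrier M" using d by auto
  have "\<zero>\<^bsub>M\<^esub> = \<zero> \<odot>\<^bsub>M\<^esub> d \<oplus>\<^bsub>M\<^esub> \<zero>\<^bsub>M\<^esub>" using d by (simp add: smult_l_null)
  then show "\<zero>\<^bsub>M\<^esub> \<in> ?P" using submodule_zero[OF K] by blast
  fix x assume "x \<in> ?P"
  then obtain r k where x: "x = r \<odot>\<^bsub>M\<^esub> d \<oplus>\<^bsub>M\<^esub> k" "r \<in> carrier R" "k \<in> K" by blast
  {
    fix y assume "y \<in> ?P"
    then obtain t k' where y: "y = t \<odot>\<^bsub>M\<^esub> d \<oplus>\<^bsub>M\<^esub> k'" "t \<in> carrier R" "k' \<in> K" by blast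
    have "x \<oplus>\<^bsub>M\<^esub> y = (r \<oplus> t) \<odot>\<^bsub>M\<^esub> d \<oplus>\<^bsub>M\<^esub> (k \<oplus>\<^bsub>M\<^esub> k')"
      using x y d by (simp add: smult_l_distr M.a_ac)
    then show "x \<oplus>\<^bsub>M\<^esub> y \<in> ?P" using x y by (auto intro!: exI)
  }
  fix a assume a: "a \<in> carrier R"
  have "a \<odot>\<^bsub>M\<^esub> x = (a \<otimes> r) \<odot>\<^bsub>M\<^esub> d \<oplus>\<^bsub>M\<^esub> a \<odot>\<^bsub>M\<^esub> k"
    using x d a by (simp add: smult_r_distr smult_assoc1)
  then show "a \<odot>\<^bsub>M\<^esub> x \<in> ?P" using x a by (auto intro!: exI)
qed

text \<open>\<open>N\<close> is generated by \<open>x + l\<close> together with \<open>K\<close>: an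
  element \<open>y = r x + m\<close> of \<open>N\<close> differs from \<open>r (x + l)\<close> by
  \<open>u = m - r l\<close>, which lies in \<open>N\<close> and in \<open>L\<close>. Replacing
  \<open>l\<close> by \<open>l'\<close> costs only \<open>r k\<close> with \<open>k = l - l'\<close>
  in \<open>K\<close>, so \<open>y\<close> also lies in \<open>N'\<close>.\<close>

lemma submodule_eq_by_coset:
  assumes N: "submodule N R M" and N': "submodule N' R M" and L: "submodule L R M"
    and gen: "\<And>y. y \<in> carrier M \<Longrightarrow> \<exists>r\<in>carrier R. \<exists>l\<in>L. y = r \<odot>\<^bsub>M\<^esub> x \<oplus>\<^bsub>M\<^esub> l"
    and x: "x \<in> carrier M" and K: "N \<inter> L = K" "N' \<inter> L = K"
    and l: "l \<in> L" "l' \<in> L" "x \<oplus>\<^bsub>M\<^esub> l \<in> N" "x \<oplus>\<^bsub>M\<^esub> l' \<in> N'" "l \<oplus>\<^bsub>M\<^esub> \<ominus>\<^bsub>M\<^esub> l' \<in> K"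
  shows "N \<subseteq> N'"
proof
  fix y assume y: "y \<in> N"
  then obtain r m where r: "r \<in> carrier R" "m \<in> L" "y = r \<odot>\<^bsub>M\<^esub> x \<oplus>\<^bsub>M\<^esub> m"
    using gen submodule_carr[OF N] by blast
  have c: "l \<in> carrier M" "l' \<in> carrier M" "m \<in> carrier M"
    using l r submodule_carr[OF L] by auto
  define u where "u = m \<oplus>\<^bsub>M\<^esub> \<ominus>\<^bsub>M\<^esub> (r \<odot>\<^bsub>M\<^esub> l)"
  have uL: "u \<in> L" using r l unfolding u_def
    by (intro submodule_add[OF L] submodule_neg[OF L] submodule_smult[OF L])
  have uc: "u \<in> carrier M" using uL submodule_carr[OF L] by auto
  have m: "m = r \<odot>\<^bsub>M\<^esub> l \<oplus>\<^bsub>M\<^esub> u"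
    using c r unfolding u_def by (simp add: M.a_ac M.r_neg2 M.r_neg M.r_neg1)
  have yu: "y = r \<odot>\<^bsub>M\<^esub> (x \<oplus>\<^bsub>M\<^esub> l) \<oplus>\<^bsub>M\<^esub> u"
    using c r x uc m by (simp add: smult_r_distr M.a_ac)
  have "u \<in> N" using y yu r l uc by (auto intro: submodule_cancel[OF N] submodule_smult[OF N])
  with uL have uN': "u \<in> N'" using K by auto
  define k where "k = l \<oplus>\<^bsub>M\<^esub> \<ominus>\<^bsub>M\<^esub> l'"
  have k: "k \<in> N'" "k \<in> carrier M" "l = l' \<oplus>\<^bsub>M\<^esub> k"
    using l K c by (auto simp: k_def M.a_ac M.r_neg)
  have "y = r \<odot>\<^bsub>M\<^esub> (x \<oplus>\<^bsub>M\<^esub> l') \<oplus>\<^bsub>M\<^esub> (r \<odot>\<^bsub>M\<^esub> k \<oplus>\<^bsub>M\<^esub> u)"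
    using yu k c r x uc by (simp add: smult_r_distr M.a_ac)
  then show "y \<in> N'"
    using l r k uN' by (auto intro!: submodule_add[OF N'] submodule_smult[OF N'])
qed

text \<open>This is the injectivity half of Schur's lemma for the map
  \<open>M / L \<rightarrow> M / K\<close> sending the class of \<open>x\<close> to that of
  \<open>d\<close>; \<open>ann\<close> makes it well defined. If \<open>r x\<close> were outside
  \<open>L\<close>, then \<open>x = t r x + l\<close> by \<open>gen\<close>, so
  \<open>1 - t r\<close> kills the class of \<open>x\<close> and hence that of \<open>d\<close>. As
  \<open>r d\<close> is in \<open>K\<close>, so is \<open>d\<close>, a contradiction.\<close>

lemma submodule_of_annihilator:
  assumes K: "submodule K R M" and L: "submodule L R M"
    and gen: "\<And>x y. x \<in> carrier M \<Longrightarrow> x \<notin> L \<Longrightarrow> y \<in> carrier M \<Longrightarrow>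
      \<exists>r\<in>carrier R. \<exists>l\<in>L. y = r \<odot>\<^bsub>M\<^esub> x \<oplus>\<^bsub>M\<^esub> l"
    and x: "x \<in> carrier M" "x \<notin> L" and d: "d \<in> carrier M" "d \<notin> K"
    and ann: "\<And>r. r \<in> carrier R \<Longrightarrow> r \<odot>\<^bsub>M\<^esub> x \<in> L \<Longrightarrow> r \<odot>\<^bsub>M\<^esub> d \<in> K"
    and r: "r \<in> carrier R" "r \<odot>\<^bsub>M\<^esub> d \<in> K"
  shows "r \<odot>\<^bsub>M\<^esub> x \<in> L"
proof (rule ccontr)
  assume nL: "r \<odot>\<^bsub>M\<^esub> x \<notin> L"
  have xc: "x \<in> carrier M" using x by simp
  have "r \<odot>\<^bsub>M\<^esub> x \<in> carrier M" using x r by simp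
  from gen[OF this nL x(1)] obtain t l where t: "t \<in> carrier R" "l \<in> L"
    "x = t \<odot>\<^bsub>M\<^esub> (r \<odot>\<^bsub>M\<^esub> x) \<oplus>\<^bsub>M\<^esub> l" by blast
  have lc: "l \<in> carrier M" using t submodule_carr[OF L] by blast
  have "(\<one> \<oplus> \<ominus> (t \<otimes> r)) \<odot>\<^bsub>M\<^esub> x = x \<oplus>\<^bsub>M\<^esub> \<ominus>\<^bsub>M\<^esub> (t \<odot>\<^bsub>M\<^esub> (r \<odot>\<^bsub>M\<^esub> x))"
    using xc r t by (simp add: smult_l_distr smult_l_minus smult_assoc1)
  also have "\<dots> = l"
  proof -
    define u where "u = t \<odot>\<^bsub>M\<^esub> (r \<odot>\<^bsub>M\<^esub> x)"
    have "u \<in> carrier M" "x = u \<oplus>\<^bsub>M\<^esub> l" using xc r t by (simp_all add: u_def)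
    then show ?thesis using lc unfolding u_def[symmetric] by (simp add: M.a_ac M.r_neg1 M.r_neg2 M.r_neg)
  qed
  finally have "(\<one> \<oplus> \<ominus> (t \<otimes> r)) \<odot>\<^bsub>M\<^esub> x \<in> L" using t by simp
  then have "(\<one> \<oplus> \<ominus> (t \<otimes> r)) \<odot>\<^bsub>M\<^esub> d \<in> K"
    using r t by (intro ann) simp_all
  moreover have "t \<odot>\<^bsub>M\<^esub> (r \<odot>\<^bsub>M\<^esub> d) \<in> K" using r t submodule_smult[OF K] by blast
  ultimately have "t \<odot>\<^bsub>M\<^esub> (r \<odot>\<^bsub>M\<^esub> d) \<oplus>\<^bsub>M\<^esub> (\<one> \<oplus> \<ominus> (t \<otimes> r)) \<odot>\<^bsub>M\<^esub> d \<in> K"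
    using submodule_add[OF K] by blast
  also have "t \<odot>\<^bsub>M\<^esub> (r \<odot>\<^bsub>M\<^esub> d) \<oplus>\<^bsub>M\<^esub> (\<one> \<oplus> \<ominus> (t \<otimes> r)) \<odot>\<^bsub>M\<^esub> d = d"
    using d r t by (simp add: smult_l_distr smult_l_minus smult_assoc1 M.a_ac M.r_neg1 M.r_neg2 M.r_neg)
  finally show False using d by simp
qed

lemma abelian_subgroup_submodule:
  assumes "submodule N R M"
  shows "abelian_subgroup N M"
  using submodule.axioms(1)[OF assms]
  by (intro abelian_subgroupI3 additive_subgroup.intro M.abelian_group_axioms)

lemma submodule_coset_eq_iff:
  assumes "submodule N R M" "x \<in> carrier M" "y \<in> carrier M"
  shows "N +>\<^bsub>M\<^esub> x = N +>\<^bsub>M\<^esub> y \<longleftrightarrow> x \<oplus>\<^bsub>M\<^esub> \<ominus>\<^bsub>M\<^esub> y \<in> N"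
proof -
  interpret N: abelian_subgroup N M by (rule abelian_subgroup_submodule[OF assms(1)])
  show ?thesis
    using N.a_rcos_module[of y x] N.a_repr_independence'[of x y] N.a_rcos_self[of x] assms by metis
qed

lemma diff_diff_cancel:
  assumes "x \<in> carrier M" "y \<in> carrier M" "z \<in> carrier M"
  shows "(x \<oplus>\<^bsub>M\<^esub> \<ominus>\<^bsub>M\<^esub> z) \<oplus>\<^bsub>M\<^esub> \<ominus>\<^bsub>M\<^esub> (y \<oplus>\<^bsub>M\<^esub> \<ominus>\<^bsub>M\<^esub> z) = x \<oplus>\<^bsub>M\<^esub> \<ominus>\<^bsub>M\<^esub> y"
proof -
  have "(x \<oplus>\<^bsub>M\<^esub> \<ominus>\<^bsub>M\<^esub> z) \<oplus>\<^bsub>M\<^esub> \<ominus>\<^bsub>M\<^esub> (y \<oplus>\<^bsub>M\<^esub> \<ominus>\<^bsub>M\<^esub> z) =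
      x \<oplus>\<^bsub>M\<^esub> (\<ominus>\<^bsub>M\<^esub> z \<oplus>\<^bsub>M\<^esub> (z \<oplus>\<^bsub>M\<^esub> \<ominus>\<^bsub>M\<^esub> y))"
    using assms by (simp add: M.minus_add M.a_ac)
  then show ?thesis using assms by (simp add: M.r_neg1)
qed

text \<open>The inductive step, phrased with elements instead of quotients. \<open>gen\<close> says
  that \<open>M / L\<close> is simple or zero. \<open>fin\<close> says that \<open>M / L\<close> has
  finitely many endomorphisms: one is determined by the class of the image \<open>s x\<close> of a
  generator \<open>x\<close>, and the condition on \<open>s\<close> is that \<open>x\<close> may be
  sent there.\<close>

lemma finite_submodules_step:
  assumes L: "submodule L R M"
    and gen: "\<And>x y. x \<in> carrier M \<Longrightarrow> x \<notin> L \<Longrightarrow> y \<in> carrier M \<Longrightarrow>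
      \<exists>r\<in>carrier R. \<exists>l\<in>L. y = r \<odot>\<^bsub>M\<^esub> x \<oplus>\<^bsub>M\<^esub> l"
    and fin: "\<And>x. x \<in> carrier M \<Longrightarrow> x \<notin> L \<Longrightarrow>
      finite {L +>\<^bsub>M\<^esub> (s \<odot>\<^bsub>M\<^esub> x) | s. s \<in> carrier R \<and>
        (\<forall>r\<in>carrier R. r \<odot>\<^bsub>M\<^esub> x \<in> L \<longrightarrow> r \<odot>\<^bsub>M\<^esub> (s \<odot>\<^bsub>M\<^esub> x) \<in> L)}"
    and finL: "finite {N. submodule N R M \<and> N \<subseteq> L}"
  shows "finite {N. submodule N R M}"
proof (cases "carrier M \<subseteq> L")
  case True
  then show ?thesis using finL submodule_subset by (auto elim!: rev_finite_subset)
next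
  case False
  then obtain x where x: "x \<in> carrier M" "x \<notin> L" by blast
  have xc: "x \<in> carrier M" using x by simp
  note Lc = submodule_carr[OF L]
  define T where "T = {N. submodule N R M \<and> \<not> N \<subseteq> L}"
  have Tsub: "submodule N R M" if "N \<in> T" for N using that by (auto simp: T_def)
  \<comment> \<open>An element \<open>m\<close> of \<open>N\<close> outside \<open>L\<close> gives
    \<open>x = r m + l\<close>, so \<open>x - l = r m\<close> is in \<open>N\<close> and the
    negative of \<open>l\<close> is the witness.\<close>
  have "\<exists>l\<in>L. x \<oplus>\<^bsub>M\<^esub> l \<in> N" if N: "N \<in> T" for N
  proof -
    obtain m where m: "m \<in> N" "m \<notin> L" "m \<in> carrier M"
      using N submodule_carr by (auto simp: T_def)
    from gen[OF m(3,2) x(1)] obtain r l where r: "r \<in> carrier R" "l \<in> L" "x = r \<odot>\<^bsub>M\<^esub> m \<oplus>\<^bsub>M\<^esub> l"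
      by blast
    have "x \<oplus>\<^bsub>M\<^esub> \<ominus>\<^bsub>M\<^esub> l = r \<odot>\<^bsub>M\<^esub> m"
      using m r Lc[OF r(2)] by (simp add: M.a_ac M.r_neg2)
    moreover have "r \<odot>\<^bsub>M\<^esub> m \<in> N" using r m submodule_smult Tsub[OF N] by blast
    ultimately show ?thesis using submodule_neg[OF L r(2)] by metis
  qed
  then obtain \<mu> where \<mu>: "\<And>N. N \<in> T \<Longrightarrow> \<mu> N \<in> L" "\<And>N. N \<in> T \<Longrightarrow> x \<oplus>\<^bsub>M\<^esub> \<mu> N \<in> N"
    by metis
  have \<mu>c: "\<mu> N \<in> carrier M" if "N \<in> T" for N using \<mu>(1)[OF that] Lc by blast
  \<comment> \<open>Within \<open>T\<close>, a submodule is determined by its intersection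
    \<open>K\<close> with \<open>L\<close> and the class of \<open>\<mu> N\<close> modulo
    \<open>K\<close>. The reverse inclusion uses that the difference of the two values of
    \<open>\<mu>\<close> may be negated.\<close>
  have det: "N = N'" if "N \<in> T" "N' \<in> T" "N \<inter> L = N' \<inter> L" "\<mu> N \<oplus>\<^bsub>M\<^esub> \<ominus>\<^bsub>M\<^esub> \<mu> N' \<in> N' \<inter> L" for N N'
  proof
    note g = gen[OF x]
    show "N \<subseteq> N'"
      by (rule submodule_eq_by_coset[OF Tsub[OF that(1)] Tsub[OF that(2)] L g xc that(3) refl
            \<mu>(1)[OF that(1)] \<mu>(1)[OF that(2)] \<mu>(2)[OF that(1)] \<mu>(2)[OF that(2)] that(4)])
    have "submodule (N' \<inter> L) R M" using Tsub that L by (blast intro: submodule_inter)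
    from submodule_neg[OF this that(4)] have "\<mu> N' \<oplus>\<^bsub>M\<^esub> \<ominus>\<^bsub>M\<^esub> \<mu> N \<in> N' \<inter> L"
      using \<mu>c that by (simp add: M.minus_add M.a_comm)
    then show "N' \<subseteq> N"
      by (intro submodule_eq_by_coset[OF Tsub[OF that(2)] Tsub[OF that(1)] L g xc refl that(3)
            \<mu>(1)[OF that(2)] \<mu>(1)[OF that(1)] \<mu>(2)[OF that(2)] \<mu>(2)[OF that(1)]])
  qed
  have "finite T"
  proof (rule finite_fibres)
    show "finite ((\<lambda>N. N \<inter> L) ` T)"
      by (rule finite_subset[OF _ finL]) (auto intro: submodule_inter[OF Tsub L])
  next
    \<comment> \<open>The fibre over \<open>K = N0 \<inter> L\<close>, with \<open>N0\<close> as
      base point.\<close>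
    fix N0 assume N0: "N0 \<in> T"
    define K where "K = N0 \<inter> L"
    have K: "submodule K R M" unfolding K_def by (rule submodule_inter[OF Tsub[OF N0] L])
    have KL: "K \<subseteq> L" by (auto simp: K_def)
    note Kc = submodule_carr[OF K]
    \<comment> \<open>Sending \<open>x\<close> to \<open>\<mu> N\<close> need not respect the
      relations of \<open>x\<close> modulo \<open>L\<close>, but the defect is the same modulo
      \<open>K\<close> for every \<open>N\<close> in the fibre. Subtracting the base point removes
      it, so that \<open>x\<close> to \<open>d N\<close> induces a homomorphism
      \<open>M / L \<rightarrow> L / K\<close>.\<close>
    define d where "d = (\<lambda>N. \<mu> N \<oplus>\<^bsub>M\<^esub> \<ominus>\<^bsub>M\<^esub> \<mu> N0)"
    define F where "F = {N \<in> T. N \<inter> L = K}"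
    have FT: "N \<in> T" "N \<inter> L = K" if "N \<in> F" for N using that by (auto simp: F_def)
    have dL: "d N \<in> L" if "N \<in> F" for N
      unfolding d_def by (intro submodule_add[OF L] submodule_neg[OF L] \<mu> FT that N0)
    have dc: "d N \<in> carrier M" if "N \<in> F" for N using dL[OF that] Lc by blast
    have sameK: "N = N'" if "N \<in> F" "N' \<in> F" "d N \<oplus>\<^bsub>M\<^esub> \<ominus>\<^bsub>M\<^esub> d N' \<in> K" for N N'
    proof (rule det)
      have "d N \<oplus>\<^bsub>M\<^esub> \<ominus>\<^bsub>M\<^esub> d N' = \<mu> N \<oplus>\<^bsub>M\<^esub> \<ominus>\<^bsub>M\<^esub> \<mu> N'"
        using \<mu>c FT that N0 by (simp add: d_def diff_diff_cancel)
      then show "\<mu> N \<oplus>\<^bsub>M\<^esub> \<ominus>\<^bsub>M\<^esub> \<mu> N' \<in> N' \<inter> L" using that FT by metis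
    qed (use that FT in auto)
    \<comment> \<open>If \<open>r x\<close> is in \<open>L\<close>, then
      \<open>r (x + \<mu> N)\<close> lies both in \<open>L\<close> and in \<open>N\<close>.\<close>
    have annN: "r \<odot>\<^bsub>M\<^esub> (x \<oplus>\<^bsub>M\<^esub> \<mu> N) \<in> K" if "N \<in> F" "r \<in> carrier R" "r \<odot>\<^bsub>M\<^esub> x \<in> L" for N r
    proof -
      have "r \<odot>\<^bsub>M\<^esub> (x \<oplus>\<^bsub>M\<^esub> \<mu> N) \<in> L"
        using that \<mu>(1) \<mu>c FT xc
        by (simp add: smult_r_distr submodule_add[OF L] submodule_smult[OF L])
      moreover have "r \<odot>\<^bsub>M\<^esub> (x \<oplus>\<^bsub>M\<^esub> \<mu> N) \<in> N"
        using that submodule_smult[OF Tsub] \<mu>(2) FT by blast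
      ultimately show ?thesis using FT that by blast
    qed
    have N0F: "N0 \<in> F" using N0 by (simp add: F_def K_def)
    \<comment> \<open>Well-definedness of the homomorphism attached to \<open>N\<close>: subtract
      the instances of \<open>annN\<close> for \<open>N\<close> and \<open>N0\<close>.\<close>
    have ann: "r \<odot>\<^bsub>M\<^esub> d N \<in> K" if "N \<in> F" "r \<in> carrier R" "r \<odot>\<^bsub>M\<^esub> x \<in> L" for N r
    proof -
      have "r \<odot>\<^bsub>M\<^esub> (x \<oplus>\<^bsub>M\<^esub> \<mu> N) \<oplus>\<^bsub>M\<^esub> \<ominus>\<^bsub>M\<^esub> (r \<odot>\<^bsub>M\<^esub> (x \<oplus>\<^bsub>M\<^esub> \<mu> N0)) \<in> K"
        using annN that N0F submodule_add[OF K] submodule_neg[OF K] by blast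
      moreover have "x \<oplus>\<^bsub>M\<^esub> \<mu> N = d N \<oplus>\<^bsub>M\<^esub> (x \<oplus>\<^bsub>M\<^esub> \<mu> N0)"
        unfolding d_def using xc \<mu>c FT that N0 by (simp add: M.a_ac M.r_neg M.r_neg1 M.r_neg2)
      then have "r \<odot>\<^bsub>M\<^esub> (x \<oplus>\<^bsub>M\<^esub> \<mu> N) = r \<odot>\<^bsub>M\<^esub> d N \<oplus>\<^bsub>M\<^esub> r \<odot>\<^bsub>M\<^esub> (x \<oplus>\<^bsub>M\<^esub> \<mu> N0)"
        using xc \<mu>c dc FT that N0 by (simp add: smult_r_distr)
      ultimately show ?thesis
        using xc \<mu>c dc FT that N0 by (simp add: M.a_assoc M.r_neg)
    qed
    \<comment> \<open>As \<open>x\<close> generates \<open>M / L\<close>, the image of this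
      homomorphism is generated by the class of \<open>d N\<close>. \<open>P N\<close> is the
      submodule of \<open>L\<close> containing \<open>K\<close> that corresponds to the image, so
      \<open>finL\<close> leaves finitely many possibilities.\<close>
    define P where "P = (\<lambda>N. {r \<odot>\<^bsub>M\<^esub> d N \<oplus>\<^bsub>M\<^esub> k | r k. r \<in> carrier R \<and> k \<in> K})"
    have dP: "d N \<in> P N" if "N \<in> F" for N
    proof -
      have "d N = \<one> \<odot>\<^bsub>M\<^esub> d N \<oplus>\<^bsub>M\<^esub> \<zero>\<^bsub>M\<^esub>" using dc that by simp
      then show ?thesis unfolding P_def using submodule_zero[OF K] by blast
    qed
    have "finite F"
    proof (rule finite_fibres)
      have "P N \<subseteq> L" if "N \<in> F" for N
        using dL[OF that] KL unfolding P_def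
        by (auto intro!: submodule_add[OF L] submodule_smult[OF L])
      then show "finite (P ` F)"
        using submodule_cyclic_plus[OF K dc]
        by (intro finite_subset[OF _ finL]) (auto simp: P_def)
    next
      fix N1 assume N1: "N1 \<in> F"
      define G where "G = {N \<in> F. P N = P N1}"
      have GF: "N \<in> F" if "N \<in> G" for N using that by (simp add: G_def)
      have "\<exists>s\<in>carrier R. \<exists>k\<in>K. d N = s \<odot>\<^bsub>M\<^esub> d N1 \<oplus>\<^bsub>M\<^esub> k" if "N \<in> G" for N
      proof -
        have "d N \<in> P N1" using dP[OF GF[OF that]] that by (simp add: G_def)
        then show ?thesis by (auto simp: P_def)
      qed
      \<comment> \<open>When \<open>d N1\<close> is not in \<open>K\<close>, the homomorphism of
        \<open>N1\<close> is injective. Its inverse on the common image, composed with the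
        homomorphism of \<open>N\<close>, is the endomorphism of \<open>M / L\<close> taking the
        class of \<open>x\<close> to that of \<open>\<sigma> N x\<close>.\<close>
      then obtain \<sigma> \<kappa> where \<sigma>: "\<And>N. N \<in> G \<Longrightarrow> \<sigma> N \<in> carrier R" "\<And>N. N \<in> G \<Longrightarrow> \<kappa> N \<in> K"
        "\<And>N. N \<in> G \<Longrightarrow> d N = \<sigma> N \<odot>\<^bsub>M\<^esub> d N1 \<oplus>\<^bsub>M\<^esub> \<kappa> N"
        by metis
      have \<kappa>c: "\<kappa> N \<in> carrier M" if "N \<in> G" for N using \<sigma>(2)[OF that] Kc by blast
      \<comment> \<open>If \<open>d N1\<close> is in \<open>K\<close>, the homomorphisms are all
        zero and \<open>G\<close> contains only \<open>N1\<close>. Otherwise \<open>G\<close> embeds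
        into the finite set \<open>?E\<close> of classes of images of \<open>x\<close> under
        endomorphisms.\<close>
      have "finite G"
      proof (cases "d N1 \<in> K")
        case True
        have "N = N1" if "N \<in> G" for N
        proof (rule sameK[OF GF[OF that] N1])
          have "d N \<in> K" unfolding \<sigma>(3)[OF that]
            using \<sigma>(1,2)[OF that] True by (intro submodule_add[OF K] submodule_smult[OF K])
          then show "d N \<oplus>\<^bsub>M\<^esub> \<ominus>\<^bsub>M\<^esub> d N1 \<in> K"
            using True submodule_add[OF K] submodule_neg[OF K] by blast
        qed
        then have "G \<subseteq> {N1}" by blast
        then show ?thesis by (rule finite_subset) simp
      next
        case False
        let ?E = "{L +>\<^bsub>M\<^esub> (s \<odot>\<^bsub>M\<^esub> x) | s. s \<in> carrier R \<and>
          (\<forall>r\<in>carrier R. r \<odot>\<^bsub>M\<^esub> x \<in> L \<longrightarrow> r \<odot>\<^bsub>M\<^esub> (s \<odot>\<^bsub>M\<^esub> x) \<in> L)}"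
        \<comment> \<open>The class of \<open>\<sigma> N x\<close> is an admissible image of
          \<open>x\<close>: \<open>r x\<close> in \<open>L\<close> gives \<open>r d N\<close> in
          \<open>K\<close>, hence \<open>r (\<sigma> N) d N1\<close> in \<open>K\<close>, and
          injectivity for \<open>N1\<close> carries this back to \<open>x\<close>.\<close>
        have "r \<odot>\<^bsub>M\<^esub> (\<sigma> N \<odot>\<^bsub>M\<^esub> x) \<in> L" if N: "N \<in> G" and r: "r \<in> carrier R" "r \<odot>\<^bsub>M\<^esub> x \<in> L" for N r
        proof -
          have "r \<odot>\<^bsub>M\<^esub> d N \<in> K" by (rule ann[OF GF[OF N] r])
          also have "r \<odot>\<^bsub>M\<^esub> d N = r \<odot>\<^bsub>M\<^esub> \<kappa> N \<oplus>\<^bsub>M\<^esub> (r \<otimes> \<sigma> N) \<odot>\<^bsub>M\<^esub> d N1"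
            unfolding \<sigma>(3)[OF N] using r \<sigma>(1)[OF N] \<kappa>c[OF N] dc[OF N1]
            by (simp add: smult_r_distr smult_assoc1 M.a_comm)
          finally have "(r \<otimes> \<sigma> N) \<odot>\<^bsub>M\<^esub> d N1 \<in> K"
            using r \<sigma>(1)[OF N] dc[OF N1]
            by - (rule submodule_cancel[OF K submodule_smult[OF K r(1) \<sigma>(2)[OF N]]]; simp)
          then have "(r \<otimes> \<sigma> N) \<odot>\<^bsub>M\<^esub> x \<in> L"
            using r \<sigma>(1)[OF N]
            by - (rule submodule_of_annihilator[OF K L gen x dc[OF N1] False ann[OF N1]]; simp)
          then show ?thesis using r \<sigma>(1)[OF N] xc by (simp add: smult_assoc1)
        qed
        then have "(\<lambda>N. L +>\<^bsub>M\<^esub> (\<sigma> N \<odot>\<^bsub>M\<^esub> x)) ` G \<subseteq> ?E" using \<sigma>(1) by blast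
        \<comment> \<open>Equal classes put \<open>(\<sigma> N - \<sigma> N') x\<close> in
          \<open>L\<close>. By \<open>ann\<close> the same scalar sends \<open>d N1\<close> into
          \<open>K\<close>, so \<open>d N\<close> and \<open>d N'\<close> agree modulo
          \<open>K\<close> and \<open>sameK\<close> applies.\<close>
        moreover have "inj_on (\<lambda>N. L +>\<^bsub>M\<^esub> (\<sigma> N \<odot>\<^bsub>M\<^esub> x)) G"
        proof (rule inj_onI)
          fix N N' assume N: "N \<in> G" and N': "N' \<in> G"
            and eq: "L +>\<^bsub>M\<^esub> (\<sigma> N \<odot>\<^bsub>M\<^esub> x) = L +>\<^bsub>M\<^esub> (\<sigma> N' \<odot>\<^bsub>M\<^esub> x)"
          note [simp] = \<sigma>(1)[OF N] \<sigma>(1)[OF N'] \<kappa>c[OF N] \<kappa>c[OF N'] dc[OF N1] xc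
          have "(\<sigma> N \<oplus> \<ominus> \<sigma> N') \<odot>\<^bsub>M\<^esub> x \<in> L"
            using eq by (simp add: submodule_coset_eq_iff[OF L] smult_l_distr smult_l_minus)
          then have "(\<sigma> N \<oplus> \<ominus> \<sigma> N') \<odot>\<^bsub>M\<^esub> d N1 \<in> K" by (intro ann[OF N1]) simp_all
          moreover have "\<kappa> N \<oplus>\<^bsub>M\<^esub> \<ominus>\<^bsub>M\<^esub> \<kappa> N' \<in> K"
            using \<sigma>(2) N N' submodule_add[OF K] submodule_neg[OF K] by blast
          ultimately have "(\<sigma> N \<oplus> \<ominus> \<sigma> N') \<odot>\<^bsub>M\<^esub> d N1 \<oplus>\<^bsub>M\<^esub> (\<kappa> N \<oplus>\<^bsub>M\<^esub> \<ominus>\<^bsub>M\<^esub> \<kappa> N') \<in> K"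
            using submodule_add[OF K] by blast
          also have "(\<sigma> N \<oplus> \<ominus> \<sigma> N') \<odot>\<^bsub>M\<^esub> d N1 \<oplus>\<^bsub>M\<^esub> (\<kappa> N \<oplus>\<^bsub>M\<^esub> \<ominus>\<^bsub>M\<^esub> \<kappa> N') = d N \<oplus>\<^bsub>M\<^esub> \<ominus>\<^bsub>M\<^esub> d N'"
            unfolding \<sigma>(3)[OF N] \<sigma>(3)[OF N']
            by (simp add: smult_l_distr smult_l_minus M.minus_add M.a_ac)
          finally show "N = N'" by (rule sameK[OF GF[OF N] GF[OF N']])
        qed
        ultimately show ?thesis by (rule finite_imageD[OF finite_subset[OF _ fin[OF x]]])
      qed
      then show "finite {N \<in> F. P N = P N1}" by (simp add: G_def)
    qed
    then show "finite {N \<in> T. N \<inter> L = N0 \<inter> L}" by (simp add: F_def K_def)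
  qed
  then have "finite (T \<union> {N. submodule N R M \<and> N \<subseteq> L})" using finL by simp
  then show ?thesis by (rule rev_finite_subset) (auto simp: T_def)
qed

section \<open>Quotients, simple modules and endomorphisms of cyclic modules\<close>

lemma quot_carrier: "carrier (quot_module M N) = (\<lambda>x. N +>\<^bsub>M\<^esub> x) ` carrier M"
  by (auto simp: quot_module_def A_RCOSETS_def')

lemma quot_add:
  assumes "submodule N R M" "x \<in> carrier M" "y \<in> carrier M"
  shows "(N +>\<^bsub>M\<^esub> x) \<oplus>\<^bsub>quot_module M N\<^esub> (N +>\<^bsub>M\<^esub> y) = N +>\<^bsub>M\<^esub> (x \<oplus>\<^bsub>M\<^esub> y)"
proof -
  interpret N: abelian_subgroup N M by (rule abelian_subgroup_submodule[OF assms(1)])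
  show ?thesis using assms N.a_rcos_sum by (simp add: quot_module_def)
qed

lemma quot_zero: "\<zero>\<^bsub>quot_module M N\<^esub> = N"
  by (simp add: quot_module_def)

lemma coset_zero: "submodule N R M \<Longrightarrow> N +>\<^bsub>M\<^esub> \<zero>\<^bsub>M\<^esub> = N"
  using submodule_subset by (simp add: M.a_coset_add_zero)

lemma coset_eq_self_iff:
  assumes "submodule N R M" "x \<in> carrier M"
  shows "N +>\<^bsub>M\<^esub> x = N \<longleftrightarrow> x \<in> N"
  using submodule_coset_eq_iff[OF assms(1,2) M.zero_closed] assms
  by (simp add: coset_zero M.add.inv_one[folded a_inv_def])

lemma quot_submodule_image:
  assumes L: "submodule L R M" and N: "submodule N R M"
  shows "submodule ((\<lambda>x. L +>\<^bsub>M\<^esub> x) ` N) R (quot_module M L)"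
proof -
  interpret Q: left_module R "quot_module M L" by (rule quot_left_module[OF L])
  note [simp] = submodule_carr[OF N] submodule_add[OF N] submodule_smult[OF N]
  have "L = L +>\<^bsub>M\<^esub> \<zero>\<^bsub>M\<^esub>" using coset_zero[OF L] by simp
  then have "L \<in> (\<lambda>x. L +>\<^bsub>M\<^esub> x) ` N" using submodule_zero[OF N] by blast
  then show ?thesis
    by (auto simp: Q.submodule_iff quot_carrier quot_zero quot_add[OF L] quot_smult[OF L])
qed

lemma quot_submodule_preimage:
  assumes L: "submodule L R M" and N: "submodule N R (quot_module M L)"
  shows "submodule {x \<in> carrier M. L +>\<^bsub>M\<^esub> x \<in> N} R M"
proof -
  interpret Q: left_module R "quot_module M L" by (rule quot_left_module[OF L])
  show ?thesis unfolding submodule_iff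
    using Q.submodule_zero[OF N] Q.submodule_add[OF N] Q.submodule_smult[OF N]
    by (auto simp: quot_zero coset_zero[OF L] simp flip: quot_add[OF L] quot_smult[OF L])
qed

text \<open>The submodules of \<open>M / L\<close> correspond to those of \<open>M\<close>
  containing \<open>L\<close>, by image and preimage under the projection \<open>?q\<close>.\<close>

lemma simple_quot_iff:
  assumes L: "submodule L R M"
  shows "simple_module R (quot_module M L) \<longleftrightarrow>
    L \<noteq> carrier M \<and> (\<forall>N. submodule N R M \<and> L \<subseteq> N \<longrightarrow> N = L \<or> N = carrier M)" (is "?l \<longleftrightarrow> ?r")
proof
  let ?q = "\<lambda>x. L +>\<^bsub>M\<^esub> x"
  assume s: ?l
  have "L \<noteq> carrier M"
  proof
    assume eq: "L = carrier M"
    have "?q x = L" if "x \<in> carrier M" for x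
      using that coset_eq_self_iff[OF L that] eq by blast
    then have "carrier (quot_module M L) = {\<zero>\<^bsub>quot_module M L\<^esub>}"
      using M.zero_closed by (force simp: quot_carrier quot_zero)
    then show False using s by (simp add: simple_module_def)
  qed
  moreover have "N = L \<or> N = carrier M" if N: "submodule N R M" "L \<subseteq> N" for N
  proof -
    have "?q ` N = {L} \<or> ?q ` N = ?q ` carrier M"
      using s quot_submodule_image[OF L N(1)] by (auto simp: simple_module_def quot_carrier quot_zero)
    then show ?thesis
    proof
      assume eq: "?q ` N = {L}"
      have "x \<in> L" if "x \<in> N" for x
        using coset_eq_self_iff[OF L submodule_carr[OF N(1) that]] eq that by blast
      then show ?thesis using N by blast
    next
      assume eq: "?q ` N = ?q ` carrier M"
      have "y \<in> N" if y: "y \<in> carrier M" for y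
      proof -
        obtain x where x: "x \<in> N" "?q y = ?q x" using eq y by blast
        then have xc: "x \<in> carrier M" using submodule_carr[OF N(1)] by blast
        have "y \<oplus>\<^bsub>M\<^esub> \<ominus>\<^bsub>M\<^esub> x \<in> N" using x submodule_coset_eq_iff[OF L y xc] N by blast
        then have "\<ominus>\<^bsub>M\<^esub> x \<oplus>\<^bsub>M\<^esub> y \<in> N" using xc y by (simp add: M.a_comm)
        then show ?thesis using submodule_cancel[OF N(1) submodule_neg[OF N(1) x(1)]] y by blast
      qed
      then show ?thesis using submodule_subset[OF N(1)] by blast
    qed
  qed
  ultimately show ?r by blast
next
  let ?q = "\<lambda>x. L +>\<^bsub>M\<^esub> x"
  assume r: ?r
  obtain x where "x \<in> carrier M" "x \<notin> L" using r submodule_subset[OF L] by blast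
  then have "?q x \<in> carrier (quot_module M L)" "?q x \<noteq> L"
    using coset_eq_self_iff[OF L] by (auto simp: quot_carrier)
  then have "carrier (quot_module M L) \<noteq> {L}" by blast
  moreover have "N = {L} \<or> N = carrier (quot_module M L)" if N: "submodule N R (quot_module M L)" for N
  proof -
    interpret Q: left_module R "quot_module M L" by (rule quot_left_module[OF L])
    let ?N = "{x \<in> carrier M. ?q x \<in> N}"
    \<comment> \<open>Every element of \<open>N\<close> is a coset \<open>?q x\<close>, so
      \<open>N\<close> is recovered from its preimage.\<close>
    have im: "N = ?q ` ?N" using Q.submodule_subset[OF N] by (auto simp: quot_carrier)
    have "L \<subseteq> ?N"
      using Q.submodule_zero[OF N] coset_eq_self_iff[OF L submodule_carr[OF L]] submodule_carr[OF L]
      by (auto simp: quot_zero)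
    then have "?N = L \<or> ?N = carrier M" using r quot_submodule_preimage[OF L N] by blast
    then show ?thesis
    proof
      assume "?N = L"
      then have "N = ?q ` L" using im by simp
      also have "\<dots> = {L}"
        using submodule_zero[OF L] coset_eq_self_iff[OF L submodule_carr[OF L]] by force
      finally show ?thesis ..
    next
      assume "?N = carrier M"
      then show ?thesis using im by (simp add: quot_carrier)
    qed
  qed
  ultimately show ?l using quot_left_module[OF L] by (auto simp: simple_module_def quot_zero)
qed

text \<open>The multiples of \<open>q\<close> form a submodule, namely
  \<open>submodule_cyclic_plus\<close> with \<open>K\<close> the zero submodule. It contains
  \<open>q\<close>, so simplicity makes it everything.\<close>

lemma simple_generates:
  assumes s: "simple_module R M" and q: "q \<in> carrier M" "q \<noteq> \<zero>\<^bsub>M\<^esub>" and y: "y \<in> carrier M"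
  shows "\<exists>r\<in>carrier R. y = r \<odot>\<^bsub>M\<^esub> q"
proof -
  let ?P = "{r \<odot>\<^bsub>M\<^esub> q \<oplus>\<^bsub>M\<^esub> k | r k. r \<in> carrier R \<and> k \<in> {\<zero>\<^bsub>M\<^esub>}}"
  have "q = \<one> \<odot>\<^bsub>M\<^esub> q \<oplus>\<^bsub>M\<^esub> \<zero>\<^bsub>M\<^esub>" using q by simp
  then have "q \<in> ?P" by blast
  then have "?P = carrier M"
    using submodule_cyclic_plus[OF submodule_null q(1)] s q unfolding simple_module_def by blast
  then have "y \<in> ?P" using y by simp
  then obtain r where "r \<in> carrier R" "y = r \<odot>\<^bsub>M\<^esub> q \<oplus>\<^bsub>M\<^esub> \<zero>\<^bsub>M\<^esub>" by blast
  then show ?thesis using q by auto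
qed

text \<open>The map takes \<open>r q\<close> to \<open>r u\<close>. It does not depend on
  \<open>r\<close>, because two coefficients of the same element differ by an annihilator of
  \<open>q\<close>, which kills \<open>u\<close> by \<open>ann\<close>. Linearity holds because
  coefficients may be added and multiplied; \<open>\<rho>\<close> merely selects one for each
  element.\<close>

lemma endomorphism_of_generator:
  assumes q: "q \<in> carrier M" and gen: "\<And>y. y \<in> carrier M \<Longrightarrow> \<exists>r\<in>carrier R. y = r \<odot>\<^bsub>M\<^esub> q"
    and u: "u \<in> carrier M"
    and ann: "\<And>r. r \<in> carrier R \<Longrightarrow> r \<odot>\<^bsub>M\<^esub> q = \<zero>\<^bsub>M\<^esub> \<Longrightarrow> r \<odot>\<^bsub>M\<^esub> u = \<zero>\<^bsub>M\<^esub>"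
  shows "\<exists>f\<in>module_end R M. f q = u"
proof -
  obtain \<rho> where \<rho>: "\<And>y. y \<in> carrier M \<Longrightarrow> \<rho> y \<in> carrier R" "\<And>y. y \<in> carrier M \<Longrightarrow> \<rho> y \<odot>\<^bsub>M\<^esub> q = y"
    using gen by metis
  have cong: "r \<odot>\<^bsub>M\<^esub> u = t \<odot>\<^bsub>M\<^esub> u"
    if "r \<in> carrier R" "t \<in> carrier R" "r \<odot>\<^bsub>M\<^esub> q = t \<odot>\<^bsub>M\<^esub> q" for r t
  proof -
    have "(r \<oplus> \<ominus> t) \<odot>\<^bsub>M\<^esub> q = \<zero>\<^bsub>M\<^esub>"
      using that q by (simp add: smult_l_distr smult_l_minus M.r_neg)
    then have "(r \<oplus> \<ominus> t) \<odot>\<^bsub>M\<^esub> u = \<zero>\<^bsub>M\<^esub>" using that by (intro ann) simp_all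
    then have "r \<odot>\<^bsub>M\<^esub> u \<oplus>\<^bsub>M\<^esub> \<ominus>\<^bsub>M\<^esub> (t \<odot>\<^bsub>M\<^esub> u) = \<zero>\<^bsub>M\<^esub>"
      using that u by (simp add: smult_l_distr smult_l_minus)
    then show ?thesis using that u by (metis M.minus_equality M.minus_minus M.add.inv_closed smult_closed)
  qed
  let ?f = "\<lambda>y\<in>carrier M. \<rho> y \<odot>\<^bsub>M\<^esub> u"
  have f: "?f (r \<odot>\<^bsub>M\<^esub> q) = r \<odot>\<^bsub>M\<^esub> u" if "r \<in> carrier R" for r
  proof -
    have "\<rho> (r \<odot>\<^bsub>M\<^esub> q) \<odot>\<^bsub>M\<^esub> u = r \<odot>\<^bsub>M\<^esub> u"
      using that q \<rho> by (intro cong) simp_all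
    then show ?thesis using that q by simp
  qed
  have "?f q = u" using f[of \<one>] q u by simp
  moreover have "?f (x \<oplus>\<^bsub>M\<^esub> y) = ?f x \<oplus>\<^bsub>M\<^esub> ?f y" if "x \<in> carrier M" "y \<in> carrier M" for x y
  proof -
    have "x \<oplus>\<^bsub>M\<^esub> y = (\<rho> x \<oplus> \<rho> y) \<odot>\<^bsub>M\<^esub> q"
      using \<rho>[OF that(1)] \<rho>[OF that(2)] q by (simp add: smult_l_distr)
    then show ?thesis using f[of "\<rho> x \<oplus> \<rho> y"] \<rho> that u by (simp add: smult_l_distr)
  qed
  moreover have "?f (a \<odot>\<^bsub>M\<^esub> x) = a \<odot>\<^bsub>M\<^esub> ?f x" if "a \<in> carrier R" "x \<in> carrier M" for a x
  proof -
    have "a \<odot>\<^bsub>M\<^esub> x = (a \<otimes> \<rho> x) \<odot>\<^bsub>M\<^esub> q"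
      using \<rho>[OF that(2)] that q by (simp add: smult_assoc1)
    then show ?thesis using f[of "a \<otimes> \<rho> x"] \<rho> that u by (simp add: smult_assoc1)
  qed
  moreover have "?f \<in> carrier M \<rightarrow>\<^sub>E carrier M" using \<rho> u by auto
  ultimately have "?f \<in> module_end R M" unfolding module_end_def by blast
  with \<open>?f q = u\<close> show ?thesis by blast
qed

end

section \<open>Isomorphic copies of a module along an injection into another type\<close>

definition transport_module :: "('m \<Rightarrow> 'n) \<Rightarrow> ('r, 'm, 'b) module_scheme \<Rightarrow> ('r, 'n) module" where
  "transport_module g M =
     (let h = inv_into (carrier M) g in
      \<lparr>carrier = g ` carrier M, mult = undefined, one = undefined,
       zero = g \<zero>\<^bsub>M\<^esub>, add = (\<lambda>u v. g (h u \<oplus>\<^bsub>M\<^esub> h v)),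
       smult = (\<lambda>a u. g (a \<odot>\<^bsub>M\<^esub> h u))\<rparr>)"

context left_module
begin

context
  fixes g :: "'m \<Rightarrow> 'n"
  assumes inj: "inj_on g (carrier M)"
begin

lemma transport_carrier: "carrier (transport_module g M) = g ` carrier M"
  and transport_zero: "\<zero>\<^bsub>transport_module g M\<^esub> = g \<zero>\<^bsub>M\<^esub>"
  and transport_add: "x \<in> carrier M \<Longrightarrow> y \<in> carrier M \<Longrightarrow>
    g x \<oplus>\<^bsub>transport_module g M\<^esub> g y = g (x \<oplus>\<^bsub>M\<^esub> y)"
  and transport_smult: "x \<in> carrier M \<Longrightarrow>
    a \<odot>\<^bsub>transport_module g M\<^esub> g x = g (a \<odot>\<^bsub>M\<^esub> x)"
  using inj by (simp_all add: transport_module_def Let_def)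

lemmas transport_simps = transport_carrier transport_zero transport_add transport_smult

lemma transport_left_module: "left_module R (transport_module g M)"
proof -
  have "\<exists>y\<in>carrier M. g (y \<oplus>\<^bsub>M\<^esub> x) = g \<zero>\<^bsub>M\<^esub>" if "x \<in> carrier M" for x
    using that M.l_neg M.add.inv_closed by metis
  then have "abelian_group (transport_module g M)"
    by (intro abelian_groupI) (auto simp: transport_simps M.a_ac)
  moreover have "left_module_axioms R (transport_module g M)"
    by unfold_locales
      (auto simp: transport_simps smult_l_distr smult_r_distr smult_assoc1)
  ultimately show ?thesis using R.ring_axioms by (intro left_module.intro)
qed

lemma submodule_transport_iff:
  assumes "N \<subseteq> carrier M"
  shows "submodule (g ` N) R (transport_module g M) \<longleftrightarrow> submodule N R M"
proof -
  interpret T: left_module R "transport_module g M" by (rule transport_left_module)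
  have mem: "g x \<in> g ` N \<longleftrightarrow> x \<in> N" if "x \<in> carrier M" for x
    using inj_on_image_mem_iff[OF inj that assms] .
  have c: "x \<in> carrier M" if "x \<in> N" for x using that assms by blast
  have "g ` N \<subseteq> g ` carrier M" using assms by blast
  then show ?thesis using assms
    by (simp add: submodule_iff T.submodule_iff transport_simps mem c)
qed

lemma transport_submodule_cases:
  assumes "submodule N R (transport_module g M)"
  obtains N' where "submodule N' R M" "N = g ` N'"
proof -
  interpret T: left_module R "transport_module g M" by (rule transport_left_module)
  obtain N' where "N' \<subseteq> carrier M" "N = g ` N'"
    using T.submodule_subset[OF assms] by (auto simp: transport_simps subset_image_iff)
  then show thesis using that assms submodule_transport_iff by blast
qed

lemma transport_simple:
  assumes "simple_module R M"
  shows "simple_module R (transport_module g M)"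
  unfolding simple_module_def
proof (intro conjI allI impI transport_left_module)
  show "carrier (transport_module g M) \<noteq> {\<zero>\<^bsub>transport_module g M\<^esub>}"
  proof
    assume "carrier (transport_module g M) = {\<zero>\<^bsub>transport_module g M\<^esub>}"
    then have "g ` carrier M = g ` {\<zero>\<^bsub>M\<^esub>}" by (simp add: transport_simps)
    then have "carrier M = {\<zero>\<^bsub>M\<^esub>}" using inj_on_image_eq_iff[OF inj] by blast
    then show False using assms by (simp add: simple_module_def)
  qed
  fix N assume "submodule N R (transport_module g M)"
  then obtain N' where "submodule N' R M" "N = g ` N'" by (rule transport_submodule_cases)
  then show "N = {\<zero>\<^bsub>transport_module g M\<^esub>} \<or> N = carrier (transport_module g M)"
    using assms by (auto simp: simple_module_def transport_simps)
qed

text \<open>Conjugation by \<open>g\<close> embeds the endomorphisms of \<open>M\<close> into those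
  of its copy. Restricting \<open>?\<phi> f\<close> to the carrier makes it extensional, as
  \<open>module_end\<close> demands.\<close>

lemma finite_module_end_transport:
  assumes "finite (module_end R (transport_module g M))"
  shows "finite (module_end R M)"
proof -
  let ?T = "transport_module g M" and ?h = "inv_into (carrier M) g"
  let ?\<phi> = "\<lambda>f. \<lambda>u\<in>carrier ?T. g (f (?h u))"
  have fc: "f x \<in> carrier M" if "f \<in> module_end R M" "x \<in> carrier M" for f x
    using that by (auto simp: module_end_def)
  have hg: "?h (g x) = x" if "x \<in> carrier M" for x using inj that by simp
  have "?\<phi> f \<in> module_end R ?T" if f: "f \<in> module_end R M" for f
  proof -
    have \<phi>g: "?\<phi> f (g x) = g (f x)" if "x \<in> carrier M" for x
      using that by (simp add: transport_carrier hg)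
    have "?\<phi> f (u \<oplus>\<^bsub>?T\<^esub> v) = ?\<phi> f u \<oplus>\<^bsub>?T\<^esub> ?\<phi> f v" if uv: "u \<in> carrier ?T" "v \<in> carrier ?T" for u v
    proof -
      obtain x y where "x \<in> carrier M" "u = g x" "y \<in> carrier M" "v = g y"
        using uv by (auto simp: transport_carrier)
      then show ?thesis
        using f fc[OF f] by (simp only: transport_add \<phi>g M.add.m_closed) (simp add: module_end_def)
    qed
    moreover have "?\<phi> f (a \<odot>\<^bsub>?T\<^esub> u) = a \<odot>\<^bsub>?T\<^esub> ?\<phi> f u" if au: "a \<in> carrier R" "u \<in> carrier ?T" for a u
    proof -
      obtain x where "x \<in> carrier M" "u = g x"
        using au by (auto simp: transport_carrier)
      then show ?thesis
        using f fc[OF f] au(1) by (simp only: transport_smult \<phi>g smult_closed) (simp add: module_end_def)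
    qed
    moreover have "?\<phi> f \<in> carrier ?T \<rightarrow>\<^sub>E carrier ?T"
      using fc[OF f] by (auto simp: transport_simps hg)
    ultimately show ?thesis unfolding module_end_def by blast
  qed
  moreover have "inj_on ?\<phi> (module_end R M)"
  proof (rule inj_onI)
    fix f f' assume f: "f \<in> module_end R M" "f' \<in> module_end R M" and eq: "?\<phi> f = ?\<phi> f'"
    show "f = f'"
    proof (rule PiE_ext)
      show "f \<in> carrier M \<rightarrow>\<^sub>E carrier M" "f' \<in> carrier M \<rightarrow>\<^sub>E carrier M"
        using f by (simp_all add: module_end_def)
      fix x assume x: "x \<in> carrier M"
      have "g (f x) = g (f' x)" using fun_cong[OF eq, of "g x"] x by (simp add: transport_simps hg)
      then show "f x = f' x" using inj_onD[OF inj] fc f x by blast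
    qed
  qed
  ultimately show ?thesis using assms inj_on_finite by blast
qed

end

section \<open>Finiteness along a composition series\<close>

lemma finite_submodules_quot:
  assumes L: "submodule L R M" and s: "simple_module R (quot_module M L)"
    and fe: "finite (module_end R (quot_module M L))"
    and finL: "finite {N. submodule N R M \<and> N \<subseteq> L}"
  shows "finite {N. submodule N R M}"
proof (rule finite_submodules_step[OF L _ _ finL])
  let ?Q = "quot_module M L"
  interpret Q: left_module R ?Q by (rule quot_left_module[OF L])
  fix x assume x: "x \<in> carrier M" "x \<notin> L"
  let ?q = "\<lambda>x. L +>\<^bsub>M\<^esub> x"
  have qx: "?q x \<in> carrier ?Q" "?q x \<noteq> \<zero>\<^bsub>?Q\<^esub>"
    using x coset_eq_self_iff[OF L] by (auto simp: quot_carrier quot_zero)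
  note gen = Q.simple_generates[OF s qx]
  show "\<exists>r\<in>carrier R. \<exists>l\<in>L. y = r \<odot>\<^bsub>M\<^esub> x \<oplus>\<^bsub>M\<^esub> l" if y: "y \<in> carrier M" for y
  proof -
    obtain r where r: "r \<in> carrier R" "?q y = ?q (r \<odot>\<^bsub>M\<^esub> x)"
      using gen[of "?q y"] x y by (auto simp: quot_carrier quot_smult[OF L])
    then have "y \<oplus>\<^bsub>M\<^esub> \<ominus>\<^bsub>M\<^esub> (r \<odot>\<^bsub>M\<^esub> x) \<in> L"
      using submodule_coset_eq_iff[OF L] x y by simp
    moreover have "y = r \<odot>\<^bsub>M\<^esub> x \<oplus>\<^bsub>M\<^esub> (y \<oplus>\<^bsub>M\<^esub> \<ominus>\<^bsub>M\<^esub> (r \<odot>\<^bsub>M\<^esub> x))"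
      using x y r by (simp add: M.a_ac M.r_neg M.r_neg2)
    ultimately show ?thesis using r by blast
  qed
  \<comment> \<open>The condition on \<open>s\<close> says that every annihilator of the class of
    \<open>x\<close> kills that of \<open>s x\<close>, so some endomorphism of \<open>M / L\<close>
    takes the first class to the second. Hence the set in question lies in the image of the finite
    endomorphism set under evaluation at \<open>?q x\<close>.\<close>
  have "?q (s \<odot>\<^bsub>M\<^esub> x) \<in> (\<lambda>f. f (?q x)) ` module_end R ?Q"
    if s: "s \<in> carrier R" "\<forall>r\<in>carrier R. r \<odot>\<^bsub>M\<^esub> x \<in> L \<longrightarrow> r \<odot>\<^bsub>M\<^esub> (s \<odot>\<^bsub>M\<^esub> x) \<in> L" for s
  proof -
    have "\<exists>f\<in>module_end R ?Q. f (?q x) = ?q (s \<odot>\<^bsub>M\<^esub> x)"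
    proof (rule Q.endomorphism_of_generator[OF qx(1) gen])
      show "?q (s \<odot>\<^bsub>M\<^esub> x) \<in> carrier ?Q" using s x by (simp add: quot_carrier)
      fix r assume "r \<in> carrier R" "r \<odot>\<^bsub>?Q\<^esub> ?q x = \<zero>\<^bsub>?Q\<^esub>"
      then show "r \<odot>\<^bsub>?Q\<^esub> ?q (s \<odot>\<^bsub>M\<^esub> x) = \<zero>\<^bsub>?Q\<^esub>"
        using s x by (simp add: quot_smult[OF L] quot_zero coset_eq_self_iff[OF L])
    qed
    then show ?thesis by blast
  qed
  then show "finite {?q (s \<odot>\<^bsub>M\<^esub> x) | s. s \<in> carrier R \<and>
      (\<forall>r\<in>carrier R. r \<odot>\<^bsub>M\<^esub> x \<in> L \<longrightarrow> r \<odot>\<^bsub>M\<^esub> (s \<odot>\<^bsub>M\<^esub> x) \<in> L)}"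
    by (intro finite_subset[OF _ finite_imageI[OF fe, of "\<lambda>f. f (?q x)"]]) auto
qed

text \<open>Induction on the index, starting from the zero submodule. Each step applies
  \<open>finite_submodules_quot\<close> inside \<open>M\<close> with carrier
  \<open>Ns ! Suc i\<close>, whose submodules are those of \<open>M\<close> contained in
  \<open>Ns ! Suc i\<close>.\<close>

lemma finite_submodules_of_composition_series:
  assumes series: "composition_series R M Ns"
    and fe: "\<And>i. Suc i < length Ns \<Longrightarrow>
      finite (module_end R (quot_module (M\<lparr>carrier := Ns ! Suc i\<rparr>) (Ns ! i)))"
  shows "finite {N. submodule N R M}"
proof -
  have sub: "submodule (Ns ! i) R M" if "i < length Ns" for i
    using series that by (simp add: composition_series_def)
  have "finite {N. submodule N R M \<and> N \<subseteq> Ns ! i}" if "i < length Ns" for i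
    using that
  proof (induction i)
    case 0
    have "Ns ! 0 = {\<zero>\<^bsub>M\<^esub>}"
      using series hd_conv_nth[of Ns] by (simp add: composition_series_def)
    then show ?case by (auto intro: finite_subset[of _ "Pow {\<zero>\<^bsub>M\<^esub>}"])
  next
    case (Suc i)
    let ?M = "M\<lparr>carrier := Ns ! Suc i\<rparr>"
    interpret A: left_module R ?M by (rule submodule_left_module[OF sub[OF Suc.prems]])
    note restrict = submodule_restrict_iff[OF sub[OF Suc.prems]]
    have le: "Ns ! i \<subseteq> Ns ! Suc i" and s: "simple_module R (quot_module ?M (Ns ! i))"
      using series Suc.prems by (simp_all add: composition_series_def)
    have "finite {N. submodule N R ?M}"
    proof (rule A.finite_submodules_quot[OF _ s fe])
      show "submodule (Ns ! i) R ?M" using restrict sub Suc.prems le by simp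
      have "finite {N. submodule N R M \<and> N \<subseteq> Ns ! i}" using Suc by simp
      then show "finite {N. submodule N R ?M \<and> N \<subseteq> Ns ! i}"
        by (rule rev_finite_subset) (auto simp: restrict)
    qed (use Suc.prems in simp)
    then show ?case by (simp add: restrict)
  qed
  moreover have "Ns \<noteq> []" "Ns ! (length Ns - 1) = carrier M"
    using series last_conv_nth[of Ns] by (simp_all add: composition_series_def)
  ultimately have "finite {N. submodule N R M \<and> N \<subseteq> carrier M}"
    by (metis diff_less length_greater_0_conv zero_less_one)
  then show ?thesis using submodule_subset by (auto elim!: rev_finite_subset)
qed

text \<open>A chosen representative determines its coset. Thus a quotient, whose elements are sets,
  can be copied into the type of \<open>M\<close>.\<close>

lemma quot_inj_representatives:
  assumes L: "submodule L R M"
  obtains g :: "'m set \<Rightarrow> 'm" where "inj_on g (carrier (quot_module M L))"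
proof
  interpret L: abelian_subgroup L M by (rule abelian_subgroup_submodule[OF L])
  let ?g = "\<lambda>X. SOME x. x \<in> carrier M \<and> X = L +>\<^bsub>M\<^esub> x"
  show "inj_on ?g (carrier (quot_module M L))"
  proof (rule inj_on_inverseI)
    fix X assume "X \<in> carrier (quot_module M L)"
    then have "\<exists>x. x \<in> carrier M \<and> X = L +>\<^bsub>M\<^esub> x" by (auto simp: quot_carrier)
    from someI_ex[OF this] show "L +>\<^bsub>M\<^esub> ?g X = X" by simp
  qed
qed

end

section \<open>The square of a module and its submodules\<close>

definition square_module :: "('r, 'm, 'b) module_scheme \<Rightarrow> ('r, 'm \<times> 'm) module" where
  "square_module S =
     \<lparr>carrier = carrier S \<times> carrier S, mult = undefined, one = undefined,
      zero = (\<zero>\<^bsub>S\<^esub>, \<zero>\<^bsub>S\<^esub>),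
      add = (\<lambda>u v. (fst u \<oplus>\<^bsub>S\<^esub> fst v, snd u \<oplus>\<^bsub>S\<^esub> snd v)),
      smult = (\<lambda>a u. (a \<odot>\<^bsub>S\<^esub> fst u, a \<odot>\<^bsub>S\<^esub> snd u))\<rparr>"

lemma square_module_simps [simp]:
  "carrier (square_module S) = carrier S \<times> carrier S"
  "\<zero>\<^bsub>square_module S\<^esub> = (\<zero>\<^bsub>S\<^esub>, \<zero>\<^bsub>S\<^esub>)"
  "(x, y) \<oplus>\<^bsub>square_module S\<^esub> (x', y') = (x \<oplus>\<^bsub>S\<^esub> x', y \<oplus>\<^bsub>S\<^esub> y')"
  "a \<odot>\<^bsub>square_module S\<^esub> (x, y) = (a \<odot>\<^bsub>S\<^esub> x, a \<odot>\<^bsub>S\<^esub> y)"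
  by (simp_all add: square_module_def)

context left_module
begin

lemma square_left_module: "left_module R (square_module M)"
proof -
  have "\<exists>u\<in>carrier M. \<exists>v\<in>carrier M. u \<oplus>\<^bsub>M\<^esub> x = \<zero>\<^bsub>M\<^esub> \<and> v \<oplus>\<^bsub>M\<^esub> y = \<zero>\<^bsub>M\<^esub>"
    if "x \<in> carrier M" "y \<in> carrier M" for x y
    using that M.l_neg M.add.inv_closed by metis
  then have "abelian_group (square_module M)"
    by (intro abelian_groupI) (auto simp: M.a_ac)
  moreover have "left_module_axioms R (square_module M)"
    by unfold_locales (auto simp: smult_l_distr smult_r_distr smult_assoc1)
  ultimately show ?thesis using R.ring_axioms by (intro left_module.intro)
qed

text \<open>The graph \<open>?\<Gamma> f\<close> of an endomorphism is a submodule of the square.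
  Distinct endomorphisms have distinct graphs, since extensional functions are determined on the
  carrier.\<close>

lemma infinite_submodules_square:
  assumes "infinite (module_end R M)"
  shows "infinite {N. submodule N R (square_module M)}"
proof
  interpret P: left_module R "square_module M" by (rule square_left_module)
  let ?\<Gamma> = "\<lambda>f. (\<lambda>x. (x, f x)) ` carrier M"
  assume fin: "finite {N. submodule N R (square_module M)}"
  have "submodule (?\<Gamma> f) R (square_module M)" if f: "f \<in> module_end R M" for f
  proof -
    have fc: "f x \<in> carrier M" if "x \<in> carrier M" for x
      using f that by (auto simp: module_end_def)
    have add: "f (x \<oplus>\<^bsub>M\<^esub> y) = f x \<oplus>\<^bsub>M\<^esub> f y" if "x \<in> carrier M" "y \<in> carrier M" for x y
      using f that by (auto simp: module_end_def)
    have lin: "f (a \<odot>\<^bsub>M\<^esub> x) = a \<odot>\<^bsub>M\<^esub> f x" if "a \<in> carrier R" "x \<in> carrier M" for a x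
      using f that by (auto simp: module_end_def)
    \<comment> \<open>Linearity at the zero scalar already forces \<open>f\<close> to fix
      zero.\<close>
    have "f \<zero>\<^bsub>M\<^esub> = \<zero>\<^bsub>M\<^esub>"
      using lin[OF R.zero_closed M.zero_closed] fc by (simp add: smult_l_null)
    then show ?thesis
      unfolding P.submodule_iff by (auto simp: fc add lin intro!: image_eqI)
  qed
  moreover have "inj_on ?\<Gamma> (module_end R M)"
  proof (rule inj_onI)
    fix f f' assume f: "f \<in> module_end R M" "f' \<in> module_end R M" and eq: "?\<Gamma> f = ?\<Gamma> f'"
    show "f = f'"
    proof (rule PiE_ext)
      show "f \<in> carrier M \<rightarrow>\<^sub>E carrier M" "f' \<in> carrier M \<rightarrow>\<^sub>E carrier M"
        using f by (simp_all add: module_end_def)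
      fix x assume "x \<in> carrier M"
      then have "(x, f x) \<in> ?\<Gamma> f'" unfolding eq[symmetric] by blast
      then show "f x = f' x" by auto
    qed
  qed
  ultimately have "finite (module_end R M)"
    using fin by (intro inj_on_finite[of ?\<Gamma> _ "{N. submodule N R (square_module M)}"]) auto
  then show False using assms by simp
qed

text \<open>\<open>F\<close> and the quotient of the square by \<open>F\<close> are both copies of
  the simple module \<open>M\<close>. The claims express this through submodules below and above
  \<open>F\<close>, in the form needed for a composition series through \<open>F\<close>.\<close>

lemma square_submodules:
  assumes s: "simple_module R M"
  defines "F \<equiv> carrier M \<times> {\<zero>\<^bsub>M\<^esub>}" and "P \<equiv> square_module M"
  shows "submodule F R P"
    and "submodule N R P \<Longrightarrow> N \<subseteq> F \<Longrightarrow> N = {\<zero>\<^bsub>P\<^esub>} \<or> N = F"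
    and "submodule N R P \<Longrightarrow> F \<subseteq> N \<Longrightarrow> N = F \<or> N = carrier P"
    and "F \<noteq> {\<zero>\<^bsub>P\<^esub>}" and "F \<noteq> carrier P"
proof -
  interpret P: left_module R P unfolding P_def by (rule square_left_module)
  show "submodule F R P" unfolding P.submodule_iff by (auto simp: F_def P_def)
  show "F \<noteq> {\<zero>\<^bsub>P\<^esub>}" "F \<noteq> carrier P"
    using s M.zero_closed by (auto simp: F_def P_def simple_module_def)
  show "N = {\<zero>\<^bsub>P\<^esub>} \<or> N = F" if N: "submodule N R P" "N \<subseteq> F"
  proof -
    let ?N = "{x. (x, \<zero>\<^bsub>M\<^esub>) \<in> N}"
    have "submodule ?N R M" unfolding submodule_iff
      using P.submodule_zero[OF N(1)] P.submodule_subset[OF N(1)]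
        P.submodule_add[OF N(1), of "(_, \<zero>\<^bsub>M\<^esub>)" "(_, \<zero>\<^bsub>M\<^esub>)"]
        P.submodule_smult[OF N(1), of _ "(_, \<zero>\<^bsub>M\<^esub>)"]
      by (auto simp: P_def)
    then have "?N = {\<zero>\<^bsub>M\<^esub>} \<or> ?N = carrier M" using s by (simp add: simple_module_def)
    moreover have "N = ?N \<times> {\<zero>\<^bsub>M\<^esub>}" using N(2) by (auto simp: F_def)
    ultimately show ?thesis by (auto simp: F_def P_def)
  qed
  show "N = F \<or> N = carrier P" if N: "submodule N R P" "F \<subseteq> N"
  proof -
    let ?N = "{y. (\<zero>\<^bsub>M\<^esub>, y) \<in> N}"
    have "submodule ?N R M" unfolding submodule_iff
      using P.submodule_zero[OF N(1)] P.submodule_subset[OF N(1)]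
        P.submodule_add[OF N(1), of "(\<zero>\<^bsub>M\<^esub>, _)" "(\<zero>\<^bsub>M\<^esub>, _)"]
        P.submodule_smult[OF N(1), of _ "(\<zero>\<^bsub>M\<^esub>, _)"]
      by (auto simp: P_def)
    then have c: "?N = {\<zero>\<^bsub>M\<^esub>} \<or> ?N = carrier M" using s by (simp add: simple_module_def)
    \<comment> \<open>Since \<open>(x, 0)\<close> lies in \<open>F\<close> and hence in
      \<open>N\<close>, it may be added or cancelled, so membership of \<open>(x, y)\<close> depends
      on \<open>y\<close> alone.\<close>
    have mem: "(x, y) \<in> N \<longleftrightarrow> y \<in> ?N" if xy: "x \<in> carrier M" "y \<in> carrier M" for x y
    proof -
      have x: "(x, \<zero>\<^bsub>M\<^esub>) \<in> N" using N(2) xy by (auto simp: F_def)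
      have eq: "(x, \<zero>\<^bsub>M\<^esub>) \<oplus>\<^bsub>P\<^esub> (\<zero>\<^bsub>M\<^esub>, y) = (x, y)" using xy by (simp add: P_def)
      show ?thesis
        using P.submodule_cancel[OF N(1) x, of "(\<zero>\<^bsub>M\<^esub>, y)"] P.submodule_add[OF N(1) x, of "(\<zero>\<^bsub>M\<^esub>, y)"] eq xy
        by (auto simp: P_def)
    qed
    have "N = carrier M \<times> ?N"
      using P.submodule_subset[OF N(1)] submodule_subset[OF \<open>submodule ?N R M\<close>] mem by (auto simp: P_def)
    then show ?thesis using c by (auto simp: F_def P_def)
  qed
qed

text \<open>By \<open>simple_quot_iff\<close>, a factor is simple exactly when its two ends differ
  and no submodule lies strictly between them.\<close>

lemma composition_series_length_two:
  assumes F: "submodule F R M" "F \<noteq> {\<zero>\<^bsub>M\<^esub>}" "F \<noteq> carrier M"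
    and below: "\<And>N. submodule N R M \<Longrightarrow> N \<subseteq> F \<Longrightarrow> N = {\<zero>\<^bsub>M\<^esub>} \<or> N = F"
    and above: "\<And>N. submodule N R M \<Longrightarrow> F \<subseteq> N \<Longrightarrow> N = F \<or> N = carrier M"
  shows "composition_series R M [{\<zero>\<^bsub>M\<^esub>}, F, carrier M]"
proof -
  interpret F: left_module R "M\<lparr>carrier := F\<rparr>" by (rule submodule_left_module[OF F(1)])
  have "simple_module R (quot_module (M\<lparr>carrier := F\<rparr>) {\<zero>\<^bsub>M\<^esub>})"
    using F below submodule_zero[OF F(1)]
    by (subst F.simple_quot_iff) (auto simp: submodule_restrict_iff[OF F(1)] submodule_null)
  moreover have "simple_module R (quot_module (M\<lparr>carrier := carrier M\<rparr>) F)"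
    using F above simple_quot_iff[OF F(1)] by auto
  ultimately show ?thesis
    using submodule_zero[OF F(1)] submodule_subset[OF F(1)]
    by (auto simp: composition_series_def nth_Cons submodule_null submodule_carrier F(1)
        less_Suc_eq split: nat.split)
qed

end

section \<open>The two implications, with all modules over the same type of elements\<close>

theorem corollary13:
  fixes R :: "('r, 'a) ring_scheme"
  assumes "ring R"
  shows "(\<forall>M :: ('r, 'm) module. finite_length R M \<longrightarrow> finite {N. submodule N R M})
     \<longleftrightarrow> (\<forall>S :: ('r, 'm) module. simple_module R S \<longrightarrow> finite (carrier (end_ring R S)))"
proof (intro iffI allI impI)
  fix S :: "('r, 'm) module"
  assume finite_submodules: "\<forall>M :: ('r, 'm) module. finite_length R M \<longrightarrow> finite {N. submodule N R M}"
    and s: "simple_module R S"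
  interpret S: left_module R S using s by (simp add: simple_module_def)
  have "finite (module_end R S)"
  proof (rule ccontr)
    assume inf: "infinite (module_end R S)"
    \<comment> \<open>A finite carrier would admit only finitely many extensional functions to
      itself.\<close>
    have "infinite (carrier S)"
    proof
      assume "finite (carrier S)"
      then have "finite (carrier S \<rightarrow>\<^sub>E carrier S)" by (simp add: finite_PiE)
      then have "finite (module_end R S)" by (rule rev_finite_subset) (auto simp: module_end_def)
      then show False using inf by simp
    qed
    \<comment> \<open>An infinite set is equipotent to its square. The bijection \<open>g\<close>
      moves the square of \<open>S\<close> into the type of \<open>S\<close>, where the hypothesis
      on finite length applies.\<close>
    then obtain g where g: "bij_betw g (carrier S \<times> carrier S) (carrier S)"
      using card_of_Times_same_infinite card_of_ordIso by blast
    let ?P = "square_module S" and ?F = "carrier S \<times> {\<zero>\<^bsub>S\<^esub>}"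
    interpret P: left_module R ?P by (rule S.square_left_module)
    have inj: "inj_on g (carrier ?P)" using g by (simp add: bij_betw_def)
    let ?T = "transport_module g ?P"
    interpret T: left_module R ?T by (rule P.transport_left_module[OF inj])
    note simps = P.transport_simps[OF inj]
    note F = S.square_submodules[OF s]
    note Fs = P.submodule_subset[OF F(1)]
    have image_eq: "g ` A = g ` B \<longleftrightarrow> A = B" if "A \<subseteq> carrier ?P" "B \<subseteq> carrier ?P" for A B
      using inj_on_image_eq_iff[OF inj that] .
    have "composition_series R ?T [{\<zero>\<^bsub>?T\<^esub>}, g ` ?F, carrier ?T]"
    proof (rule T.composition_series_length_two)
      show "submodule (g ` ?F) R ?T" using P.submodule_transport_iff[OF inj Fs] F(1) by simp
      show "g ` ?F \<noteq> {\<zero>\<^bsub>?T\<^esub>}" "g ` ?F \<noteq> carrier ?T"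
        using image_eq[OF Fs, of "{\<zero>\<^bsub>?P\<^esub>}"] image_eq[OF Fs, of "carrier ?P"] F(4,5)
        by (simp_all add: simps(1,2))
      fix N assume N: "submodule N R ?T"
      then obtain N' where N': "submodule N' R ?P" "N = g ` N'"
        by (rule P.transport_submodule_cases[OF inj])
      \<comment> \<open>Injectivity of \<open>g\<close> on the carrier lets inclusions between
        images be read back in the square.\<close>
      have iff: "g ` A \<subseteq> g ` B \<longleftrightarrow> A \<subseteq> B" if "A \<subseteq> carrier ?P" "B \<subseteq> carrier ?P" for A B
        using inj_on_image_mem_iff[OF inj _ that(2)] that by blast
      show "N = {\<zero>\<^bsub>?T\<^esub>} \<or> N = g ` ?F" if "N \<subseteq> g ` ?F"
        using that iff[OF P.submodule_subset[OF N'(1)] Fs] F(2)[OF N'(1)]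
        unfolding N'(2) simps(2) by auto
      show "N = g ` ?F \<or> N = carrier ?T" if "g ` ?F \<subseteq> N"
        using that iff[OF Fs P.submodule_subset[OF N'(1)]] F(3)[OF N'(1)]
        unfolding N'(2) simps(1) by auto
    qed
    then have "finite_length R ?T" using T.left_module_axioms by (auto simp: finite_length_def)
    then have "finite {N. submodule N R ?T}" using finite_submodules by blast
    \<comment> \<open>Taking images under \<open>g\<close> embeds the submodules of the square into
      those of its copy, which are finite in number; the graphs contradict this.\<close>
    moreover have "(\<lambda>N. g ` N) ` {N. submodule N R ?P} \<subseteq> {N. submodule N R ?T}"
      using P.submodule_transport_iff[OF inj P.submodule_subset] by blast
    moreover have "inj_on (\<lambda>N. g ` N) {N. submodule N R ?P}"
      using image_eq P.submodule_subset by (auto intro!: inj_onI)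
    ultimately have "finite {N. submodule N R ?P}" using inj_on_finite by blast
    then show False using S.infinite_submodules_square[OF inf] by blast
  qed
  then show "finite (carrier (end_ring R S))" by (simp add: end_ring_def)
next
  fix M :: "('r, 'm) module"
  assume finite_end: "\<forall>S :: ('r, 'm) module. simple_module R S \<longrightarrow> finite (carrier (end_ring R S))"
    and "finite_length R M"
  then obtain Ns where "left_module R M" and series: "composition_series R M Ns"
    by (auto simp: finite_length_def)
  interpret left_module R M by fact
  show "finite {N. submodule N R M}"
  proof (rule finite_submodules_of_composition_series[OF series])
    fix i assume i: "Suc i < length Ns"
    let ?A = "M\<lparr>carrier := Ns ! Suc i\<rparr>"
    let ?Q = "quot_module ?A (Ns ! i)"
    have sub: "submodule (Ns ! i) R M" "submodule (Ns ! Suc i) R M" and le: "Ns ! i \<subseteq> Ns ! Suc i"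
      and s: "simple_module R ?Q"
      using series i by (simp_all add: composition_series_def)
    interpret A: left_module R ?A by (rule submodule_left_module[OF sub(2)])
    have "submodule (Ns ! i) R ?A" using submodule_restrict_iff[OF sub(2)] sub(1) le by blast
    \<comment> \<open>The factor \<open>?Q\<close> consists of sets, whereas
      \<open>finite_end\<close> speaks of modules with elements in \<open>'m\<close>.
      Representatives give a simple copy there, and finiteness of its endomorphism ring passes back
      to \<open>?Q\<close>.\<close>
    then obtain g :: "'m set \<Rightarrow> 'm" where g: "inj_on g (carrier ?Q)" by (rule A.quot_inj_representatives)
    interpret Q: left_module R ?Q using s by (simp add: simple_module_def)
    have "finite (carrier (end_ring R (transport_module g ?Q)))"
      using finite_end Q.transport_simple[OF g s] by blast
    then show "finite (module_end R ?Q)"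
      by (intro Q.finite_module_end_transport[OF g]) (simp add: end_ring_def)
  qed
qed

end
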